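(* Let $N\geq n\geq0$. Once the table of the numbers $R_{\ell,a}(q,s)$ (the first-coordinate quotient) and the empty-stack values $G_{(p,q)}$ have been computed for size $N$, a uniformly random element of $\mathrm{Av}_n(12453)$ can be produced with $O(n^4)$ arithmetic operations on the stored integers.
   Context: $\mathbb N=\{0,1,2,\ldots\}$. $\mathrm{Av}_n(12453)$ is the set of permutations of $\{1,\ldots,n\}$ having no subsequence in the same relative order as $12453$. A state is a pair $((p,q),L)$ with control $(p,q)\in\mathbb N^2$ and stack $L=(\ell_1,\ldots,\ell_r)$ a finite, possibly empty, list of positive integers. $\mathrm{nz}$ of a list deletes its zero entries. The transitions from $((p,q),L)$ are the following; differently indexed transitions are distinct even when their targets coincide. - Early-band moves: for each $0\le h<p$, target $((h,q+p-1-h),L)$. - Last-band moves: for each $0\le h<q$, target $((p,h),\mathrm{nz}(\ell_1+q-1-h,\ell_2,\ldots,\ell_r))$, where for an empty stack $\ell_1$ is read as $0$ and the tail as empty. - Active-head moves: if $L$ is nonempty, for each $i,j\ge0$ with $i+j=\ell_1-1$, target $((p,q),\mathrm{nz}(i,j,\ell_2,\ldots,\ell_r))$. $G_{(p,q)}$ is the number of maximal transition sequences from $((p,q),\varnothing)$ (all of which end at $((0,0),\varnothing)$); in particular $G_{(n,0)}=|\mathrm{Av}_n(12453)|$. For $\ell\ge1$ and a list $L$, a path starting at the state with control $(p,q)$ and stack $(\ell)L$ (concatenation) is stopped if it ends at a state whose stack is exactly $L$ and no earlier state on it has stack exactly $L$. $K_\ell((p,q),(c,s))$ is the number of stopped paths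 from $((p,q),(\ell)L)$ to $((c,s),L)$; this number does not depend on $L$. Put $R_{\ell,a}(q,s)=K_\ell((a,q),(0,s))$. The tables for size $N$ consist of all $R_{\ell,a}(q,s)$ with $\ell\ge1$, $a,q,s\ge0$, $\ell+a+q\le N$ (entries with $s>q$ if $a=0$, or $s>a+q-1$ if $a>0$, vanish and are not stored) and all $G_{(p,q)}$ with $p+q\le N$. Cost model: each arithmetic operation on (or comparison of) integers counts as one step, table entries can be looked up in one step, and for a stored positive integer $Y$ a uniformly random integer $y$ with $0\le y<Y$ can be drawn. *)

theory Defs
  imports
    "HOL-Probability.SPMF"
    "HOL-Library.Landau_Symbols"
    "HOL-Library.Sublist"
    "HOL-Combinatorics.Multiset_Permutations"
begin

section \<open>Pattern avoidance\<close>

definition order_isomorphic :: "nat list \<Rightarrow> nat list \<Rightarrow> bool" where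
  "order_isomorphic xs ys \<longleftrightarrow> length xs = length ys \<and>
     (\<forall>i<length xs. \<forall>j<length xs. xs ! i < xs ! j \<longleftrightarrow> ys ! i < ys ! j)"

definition contains_pattern :: "nat list \<Rightarrow> nat list \<Rightarrow> bool" where
  "contains_pattern \<pi> \<sigma> \<longleftrightarrow> (\<exists>xs. subseq xs \<pi> \<and> order_isomorphic xs \<sigma>)"

text \<open>A permutation of \<open>{1..n}\<close> is the list of its values.\<close>

definition Av :: "nat \<Rightarrow> nat list \<Rightarrow> nat list set" where
  "Av n \<sigma> = {\<pi> \<in> permutations_of_set {1..n}. \<not> contains_pattern \<pi> \<sigma>}"

section \<open>The transition system\<close>

type_synonym control = "nat \<times> nat"
type_synonym state = "control \<times> nat list"

definition nz :: "nat list \<Rightarrow> nat list" where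
  "nz L = filter (\<lambda>x. x \<noteq> 0) L"

text \<open>A move carries the index of the transition, so that a state together with a list of moves
  is a transition sequence in which differently indexed transitions are distinct.\<close>

datatype move = Early nat | Last nat | Head nat nat

inductive transition :: "state \<Rightarrow> move \<Rightarrow> state \<Rightarrow> bool" where
  early: "h < p \<Longrightarrow> transition ((p, q), L) (Early h) ((h, q + p - 1 - h), L)"
| last_empty: "h < q \<Longrightarrow> transition ((p, q), []) (Last h) ((p, h), nz [q - 1 - h])"
| last_Cons: "h < q \<Longrightarrow> transition ((p, q), l # L) (Last h) ((p, h), nz ((l + q - 1 - h) # L))"
| head: "i + j + 1 = l \<Longrightarrow> transition ((p, q), l # L) (Head i j) ((p, q), nz (i # j # L))"

inductive path :: "state \<Rightarrow> move list \<Rightarrow> state \<Rightarrow> bool" where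
  path_Nil: "path S [] S"
| path_Cons: "transition S m S' \<Longrightarrow> path S' ms S'' \<Longrightarrow> path S (m # ms) S''"

definition maximal_paths :: "state \<Rightarrow> move list set" where
  "maximal_paths S = {ms. \<exists>T. path S ms T \<and> (\<nexists>m U. transition T m U)}"

definition G :: "control \<Rightarrow> nat" where
  "G pq = card (maximal_paths (pq, []))"

definition stopped_paths :: "nat list \<Rightarrow> nat \<Rightarrow> control \<Rightarrow> control \<Rightarrow> move list set" where
  "stopped_paths L l pq cs = {ms. path (pq, l # L) ms (cs, L) \<and>
     (\<forall>k<length ms. \<forall>S. path (pq, l # L) (take k ms) S \<longrightarrow> snd S \<noteq> L)}"

lemma transition_append:
  assumes "0 \<notin> set L" "M \<noteq> []"
  shows "transition (pq, M @ L) m T \<longleftrightarrow> (\<exists>cs M'. T = (cs, M' @ L) \<and> transition (pq, M) m (cs, M'))"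
proof -
  have nzL: "filter (\<lambda>x. x \<noteq> 0) L = L" using assms by (induction L) auto
  obtain l M0 where M: "M = l # M0" using assms by (cases M) auto
  show ?thesis
    apply (cases m)
    subgoal for h using nzL unfolding M by (auto simp: transition.simps)
    subgoal for h using nzL unfolding M by (auto simp: transition.simps nz_def)
    subgoal for i j using nzL unfolding M by (auto simp: transition.simps nz_def)
    done
qed

lemma transition_deterministic: "transition S m T \<Longrightarrow> transition S m T' \<Longrightarrow> T = T'"
  by (auto elim!: transition.cases)

lemma path_simps:
  "path S [] T \<longleftrightarrow> T = S"
  "path S (m # ms) T \<longleftrightarrow> (\<exists>S'. transition S m S' \<and> path S' ms T)"
  using path.simps[of S "[]" T] path.simps[of S "m # ms" T] by simp_all

lemma stopped_path_append:
  assumes "0 \<notin> set L"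
  shows "path (pq, M @ L) ms (cs, L) \<and>
      (\<forall>k<length ms. \<forall>S. path (pq, M @ L) (take k ms) S \<longrightarrow> snd S \<noteq> L) \<longleftrightarrow>
    path (pq, M) ms (cs, []) \<and>
      (\<forall>k<length ms. \<forall>S. path (pq, M) (take k ms) S \<longrightarrow> snd S \<noteq> [])"
proof (induction ms arbitrary: pq M)
  case Nil
  then show ?case by (auto simp: path_simps)
next
  case (Cons m ms)
  have step: "path S (m # ms) T \<and> (\<forall>k<length (m # ms). \<forall>S'. path S (take k (m # ms)) S' \<longrightarrow> snd S' \<noteq> Z) \<longleftrightarrow>
     snd S \<noteq> Z \<and> (\<exists>S1. transition S m S1 \<and> path S1 ms T \<and>
       (\<forall>k<length ms. \<forall>S'. path S1 (take k ms) S' \<longrightarrow> snd S' \<noteq> Z))" for S T Z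
  proof -
    have "(\<forall>k<length (m # ms). \<forall>S'. path S (take k (m # ms)) S' \<longrightarrow> snd S' \<noteq> Z) \<longleftrightarrow>
       snd S \<noteq> Z \<and> (\<forall>S1. transition S m S1 \<longrightarrow>
         (\<forall>k<length ms. \<forall>S'. path S1 (take k ms) S' \<longrightarrow> snd S' \<noteq> Z))"
      by (simp only: list.size add_Suc_right add_0_right All_less_Suc2 take_0 take_Suc_Cons path_simps) blast
    then show ?thesis
      unfolding path_simps using transition_deterministic by blast
  qed
  show ?case
  proof (cases "M = []")
    case True
    then show ?thesis by (simp only: step) simp
  next
    case False
    have ex: "(\<exists>S1. (\<exists>cs M'. S1 = (cs, M' @ L) \<and> transition (pq, M) m (cs, M')) \<and> P S1) \<longleftrightarrow>
      (\<exists>cs M'. transition (pq, M) m (cs, M') \<and> P (cs, M' @ L))" for P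
      by blast
    have ex': "(\<exists>S1. transition (pq, M) m S1 \<and> P S1) \<longleftrightarrow>
      (\<exists>cs M'. transition (pq, M) m (cs, M') \<and> P (cs, M'))" for P
      by auto
    show ?thesis
      using False
      by (simp only: step transition_append[OF assms False] ex ex'[of "\<lambda>S1. path S1 ms (cs, []) \<and>
          (\<forall>k<length ms. \<forall>S'. path S1 (take k ms) S' \<longrightarrow> snd S' \<noteq> [])"] Cons.IH) simp
  qed
qed

text \<open>The number of stopped paths does not depend on the stack below \<open>l\<close>.\<close>

lemma stopped_paths_independent:
  assumes "0 \<notin> set L"
  shows "stopped_paths L l pq cs = stopped_paths [] l pq cs"
  using stopped_path_append[OF assms, of pq "[l]"] by (simp add: stopped_paths_def)

definition K :: "nat \<Rightarrow> control \<Rightarrow> control \<Rightarrow> nat" where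
  "K l pq cs = card (stopped_paths [] l pq cs)"

definition R :: "nat \<Rightarrow> nat \<Rightarrow> nat \<Rightarrow> nat \<Rightarrow> nat" where
  "R l a q s = K l (a, q) (0, s)"

section \<open>The tables\<close>

datatype entry = R_entry int int int int | G_entry int int

text \<open>\<open>table N e\<close> is \<open>None\<close> if the entry \<open>e\<close> is not stored in the tables for size \<open>N\<close>.\<close>

fun table :: "nat \<Rightarrow> entry \<Rightarrow> int option" where
  "table N (R_entry l a q s) =
     (if 1 \<le> l \<and> 0 \<le> a \<and> 0 \<le> q \<and> 0 \<le> s \<and> l + a + q \<le> int N \<and> s \<le> (if a = 0 then q else a + q - 1)
      then Some (int (R (nat l) (nat a) (nat q) (nat s))) else None)"
| "table N (G_entry p q) =
     (if 0 \<le> p \<and> 0 \<le> q \<and> p + q \<le> int N then Some (int (G (nat p, nat q))) else None)"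

section \<open>Programs and their cost\<close>

text \<open>The algorithm has to be one program for all \<open>n\<close> and \<open>N\<close>. Programs are those of an imperative
  language with loops over a memory consisting of named arrays of integers of unbounded size; a
  scalar variable is the cell of index 0 of an array. The tables can only be accessed by looking up
  an entry and by drawing uniformly below an entry.\<close>

type_synonym memory = "string \<Rightarrow> int \<Rightarrow> int"

datatype exp =
    Num int
  | Cell string exp
  | Plus exp exp
  | Minus exp exp
  | Times exp exp

datatype bexp =
    Less exp exp
  | BNot bexp
  | BAnd bexp bexp

datatype ref = R_ref exp exp exp exp | G_ref exp exp

datatype com =
    Skip
  | Store string exp exp  \<comment> \<open>array, index, value\<close>
  | Lookup string exp ref
  | Draw string exp ref
  | Seq com com
  | Cond bexp com com
  | While bexp com

primrec eval_exp :: "exp \<Rightarrow> memory \<Rightarrow> int" where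
  "eval_exp (Num k) m = k"
| "eval_exp (Cell x e) m = m x (eval_exp e m)"
| "eval_exp (Plus e f) m = eval_exp e m + eval_exp f m"
| "eval_exp (Minus e f) m = eval_exp e m - eval_exp f m"
| "eval_exp (Times e f) m = eval_exp e m * eval_exp f m"

primrec eval_bexp :: "bexp \<Rightarrow> memory \<Rightarrow> bool" where
  "eval_bexp (Less e f) m \<longleftrightarrow> eval_exp e m < eval_exp f m"
| "eval_bexp (BNot b) m \<longleftrightarrow> \<not> eval_bexp b m"
| "eval_bexp (BAnd b c) m \<longleftrightarrow> eval_bexp b m \<and> eval_bexp c m"

primrec eval_ref :: "ref \<Rightarrow> memory \<Rightarrow> entry" where
  "eval_ref (R_ref e f g h) m = R_entry (eval_exp e m) (eval_exp f m) (eval_exp g m) (eval_exp h m)"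
| "eval_ref (G_ref e f) m = G_entry (eval_exp e m) (eval_exp f m)"

text \<open>Besides arithmetic operations, comparisons, lookups and draws, everything else that is
  executed is charged as well (constants, memory accesses, Boolean connectives, branching), so the
  cost of a run bounds its number of arithmetic operations from above.\<close>

primrec cost_exp :: "exp \<Rightarrow> nat" where
  "cost_exp (Num k) = 1"
| "cost_exp (Cell x e) = 1 + cost_exp e"
| "cost_exp (Plus e f) = 1 + cost_exp e + cost_exp f"
| "cost_exp (Minus e f) = 1 + cost_exp e + cost_exp f"
| "cost_exp (Times e f) = 1 + cost_exp e + cost_exp f"

primrec cost_bexp :: "bexp \<Rightarrow> nat" where
  "cost_bexp (Less e f) = 1 + cost_exp e + cost_exp f"
| "cost_bexp (BNot b) = 1 + cost_bexp b"
| "cost_bexp (BAnd b c) = 1 + cost_bexp b + cost_bexp c"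

primrec cost_ref :: "ref \<Rightarrow> nat" where
  "cost_ref (R_ref e f g h) = 1 + cost_exp e + cost_exp f + cost_exp g + cost_exp h"
| "cost_ref (G_ref e f) = 1 + cost_exp e + cost_exp f"

definition store :: "string \<Rightarrow> int \<Rightarrow> int \<Rightarrow> memory \<Rightarrow> memory" where
  "store x i v m = m(x := (m x)(i := v))"

partial_function (spmf) while_spmf :: "('a \<Rightarrow> bool) \<Rightarrow> ('a \<Rightarrow> 'a spmf) \<Rightarrow> 'a \<Rightarrow> 'a spmf" where
  "while_spmf guard body s =
     (if guard s then bind_spmf (body s) (while_spmf guard body) else return_spmf s)"

text \<open>\<open>exec tab c (m, t)\<close> is the joint distribution of the final memory and of the accumulated cost
  when \<open>c\<close> is run from memory \<open>m\<close> with cost \<open>t\<close> already spent. Mass is lost by looking up an entry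
  that is not stored, by drawing below an entry that is not stored or not positive (then
  \<open>{0..<y}\<close> is empty), and by nontermination.\<close>

primrec exec :: "(entry \<Rightarrow> int option) \<Rightarrow> com \<Rightarrow> memory \<times> nat \<Rightarrow> (memory \<times> nat) spmf" where
  "exec tab Skip = (\<lambda>(m, t). return_spmf (m, t + 1))"
| "exec tab (Store x e f) = (\<lambda>(m, t).
     return_spmf (store x (eval_exp e m) (eval_exp f m) m, t + 1 + cost_exp e + cost_exp f))"
| "exec tab (Lookup x e r) = (\<lambda>(m, t). case tab (eval_ref r m) of
       None \<Rightarrow> return_pmf None
     | Some y \<Rightarrow> return_spmf (store x (eval_exp e m) y m, t + 1 + cost_exp e + cost_ref r))"
| "exec tab (Draw x e r) = (\<lambda>(m, t). case tab (eval_ref r m) of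
       None \<Rightarrow> return_pmf None
     | Some y \<Rightarrow> map_spmf (\<lambda>v. (store x (eval_exp e m) v m, t + 1 + cost_exp e + cost_ref r))
                   (spmf_of_set {0..<y}))"
| "exec tab (Seq c d) = (\<lambda>\<sigma>. bind_spmf (exec tab c \<sigma>) (exec tab d))"
| "exec tab (Cond b c d) = (\<lambda>(m, t).
     if eval_bexp b m then exec tab c (m, t + 1 + cost_bexp b)
     else exec tab d (m, t + 1 + cost_bexp b))"
| "exec tab (While b c) = (\<lambda>\<sigma>. map_spmf (\<lambda>(m, t). (m, t + 1 + cost_bexp b))
     (while_spmf (\<lambda>(m, t). eval_bexp b m) (\<lambda>(m, t). exec tab c (m, t + 1 + cost_bexp b)) \<sigma>))"

definition input :: "nat \<Rightarrow> nat \<Rightarrow> memory" where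
  "input N n = store ''N'' 0 (int N) (store ''n'' 0 (int n) (\<lambda>x i. 0))"

definition out_list :: "nat \<Rightarrow> memory \<Rightarrow> int list" where
  "out_list n m = map (\<lambda>i. m ''out'' (int i)) [0..<n]"

text \<open>The run of program \<open>c\<close> on input \<open>n\<close>, given the tables for size \<open>N\<close>: output and cost.\<close>

definition run :: "com \<Rightarrow> nat \<Rightarrow> nat \<Rightarrow> (int list \<times> nat) spmf" where
  "run c N n = map_spmf (\<lambda>(m, t). (out_list n m, t)) (exec (table N) c (input N n, 0))"

end

theory Submission
  imports Defs
begin

text \<open>
  The random choice is a single draw of \<open>y < G (n, 0)\<close>; everything after it is deterministic.
  The program computes the value at \<open>y\<close> of a bijection from \<open>{..<G (n, 0)}\<close> onto the permutations
  of \<open>{1..n}\<close> that avoid 12453, so its output is uniform. The bijection is composed of two.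

  Transition sequences and permutations. A permutation is written from left to right. In state
  \<open>((p, q), L)\<close> the \<open>p\<close> smallest values not yet written are below all written values, the next \<open>q\<close>
  are above a written value but not above a written ascent 12, and the others are above such an ascent
  and split into consecutive blocks whose sizes are the stack. Two blocks are separated by a written
  value that can play the 4 of 12453, so a value above the lowest block may not be written before that
  block is used up: it would play the 5, and what is left of the lowest block the 3. The other values
  are the legal choices, and writing one of them is a transition of the corresponding index. A
  transition sequence therefore is the same as a sequence of ranks among the remaining values, and
  decoding these ranks is a bijection onto the avoiding permutations (\<open>bij_betw_decode\<close>).

  Numbers and transition sequences. A configuration consists of a control and of a list of frames,
  each of which is a stack entry together with the control at which this entry has to be used up. The
  codes of a configuration are the transition sequences that meet all these targets; since a stopped
  path is determined as a prefix of any of its continuations, their number is a product of one number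
  \<open>K\<close> per frame and a final number \<open>G\<close> (\<open>card_codes\<close>). A first move with index \<open>x\<close> replaces the top
  entry by two, of lengths \<open>i\<close> and \<open>j\<close>, and choosing the control \<open>ct\<close> at which \<open>i\<close> is used up gives a new
  configuration. So the codes of a configuration are the disjoint union, over all \<open>x\<close> and \<open>ct\<close>, of the
  codes of the new configurations (\<open>codes_first_index\<close>), and unranking in this sum gives a bijection
  from an initial segment of the naturals (\<open>bij_betw_unrank\<close>). Frames of length 0 make this uniform: each
  kind of move, with empty and nonempty stack, pushes exactly one frame.

  Division with remainder is avoided by storing with each frame the product of the numbers of all
  frames below it: the rank stays a number below the product of all weights. The number
  \<open>K l (p, q) (c, s)\<close> depends on \<open>p\<close> and \<open>c\<close> through \<open>p - c\<close> only, hence is an entry of the table of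
  the \<open>R\<close> (\<open>Kz_eq_R\<close>). A move is found by trying at most \<open>n (n + 1)\<^sup>2\<close> pairs of an index and a
  target at constant cost each, and there are \<open>n\<close> moves and at most as many removals of empty frames.
  Hence the cost is \<open>O(n\<^sup>4)\<close>.
\<close>

section \<open>Codes of transition sequences\<close>

definition head0 :: "nat list \<Rightarrow> nat" where
  "head0 L = (case L of [] \<Rightarrow> 0 | l # _ \<Rightarrow> l)"

lemma head0_simps [simp]: "head0 [] = 0" "head0 (l # L) = l"
  by (simp_all add: head0_def)

fun room :: "state \<Rightarrow> nat" where
  "room ((p, q), L) = p + q + head0 L"

text \<open>The index \<open>x\<close> of a transition is the rank, among the remaining values, of the value that is written:
  first come the early band, then the last band, then the active head \<open>l\<close>. The result is the new control and
  the two lengths by which \<open>l\<close> is replaced, zeros included. With \<open>l = 0\<close> this covers the empty stack.\<close>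

fun branch :: "control \<Rightarrow> nat \<Rightarrow> nat \<Rightarrow> control \<times> nat \<times> nat" where
  "branch (p, q) l x =
    (if x < p then ((x, q + p - 1 - x), l, 0)
     else if x < p + q then ((p, x - p), l + q - 1 - (x - p), 0)
     else ((p, q), x - p - q, l - 1 - (x - p - q)))"

fun step :: "state \<Rightarrow> nat \<Rightarrow> state" where
  "step (pq, L) x = (case branch pq (head0 L) x of (pq', i, j) \<Rightarrow> (pq', nz (i # j # tl L)))"

text \<open>A code is the list of the indices of a transition sequence; these are the codes of the maximal ones
  from \<open>S\<close>.\<close>

fun complete :: "state \<Rightarrow> nat list \<Rightarrow> bool" where
  "complete S [] \<longleftrightarrow> room S = 0"
| "complete S (x # xs) \<longleftrightarrow> x < room S \<and> complete (step S x) xs"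

text \<open>Lehmer decoding: the elements of \<open>vs\<close> are removed one by one at the given positions.\<close>

fun decode :: "'a list \<Rightarrow> nat list \<Rightarrow> 'a list" where
  "decode vs [] = []"
| "decode vs (x # xs) = vs ! x # decode (take x vs @ drop (Suc x) vs) xs"

lemma nz_simps [simp]: "nz [] = []" "nz (0 # L) = nz L" "l \<noteq> 0 \<Longrightarrow> nz (l # L) = l # nz L"
  "nz (L @ M) = nz L @ nz M" "sum_list (nz L) = sum_list L" "0 \<notin> set (nz L)"
  by (auto simp: nz_def) (induction L, auto)

lemma nz_id: "0 \<notin> set L \<Longrightarrow> nz L = L"
  by (induction L) (auto simp: nz_def)

section \<open>Codes and permutations that avoid 12453\<close>

text \<open>The values that complete an ascent of \<open>us\<close> to a 123.\<close>

definition above_12 :: "nat list \<Rightarrow> nat \<Rightarrow> bool" where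
  "above_12 us v \<longleftrightarrow> (\<exists>a b. subseq [a, b] us \<and> a < b \<and> b < v)"

text \<open>Some \<open>u\<close> in \<open>us\<close> can play the 4 of an occurrence of 12453 with \<open>w\<close> as 5 and \<open>v\<close> as 3, both
  still to come. So \<open>w\<close> must not precede \<open>v\<close>.\<close>

definition cut :: "nat list \<Rightarrow> nat \<Rightarrow> nat \<Rightarrow> bool" where
  "cut us v w \<longleftrightarrow> (\<exists>a b u. subseq [a, b, u] us \<and> a < b \<and> b < v \<and> v < u \<and> u < w)"

lemma subseq_snoc_iff:
  "subseq (xs @ [x]) (ys @ [y]) \<longleftrightarrow> subseq (xs @ [x]) ys \<or> x = y \<and> subseq xs ys"
proof (induction ys arbitrary: xs)
  case Nil
  then show ?case by (cases xs) auto
next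
  case (Cons a ys)
  note IH = Cons
  show ?case
  proof (cases xs)
    case Nil
    then show ?thesis using IH[of "[]"] by (auto simp: subseq_singleton_left)
  next
    case (Cons b zs)
    then show ?thesis using IH[of zs] IH[of xs] by (cases "a = b") auto
  qed
qed

lemma above_12_snoc: "above_12 (us @ [z]) v \<longleftrightarrow> above_12 us v \<or> (\<exists>a\<in>set us. a < z) \<and> z < v"
proof -
  have "subseq [a, b] (us @ [z]) \<longleftrightarrow> subseq [a, b] us \<or> b = z \<and> a \<in> set us" for a b
    using subseq_snoc_iff[of "[a]" b us z] by (simp add: subseq_singleton_left)
  then show ?thesis unfolding above_12_def by blast
qed

lemma cut_snoc: "cut (us @ [z]) v w \<longleftrightarrow> cut us v w \<or> above_12 us v \<and> v < z \<and> z < w"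
proof -
  have "subseq [a, b, u] (us @ [z]) \<longleftrightarrow> subseq [a, b, u] us \<or> u = z \<and> subseq [a, b] us" for a b u
    using subseq_snoc_iff[of "[a, b]" u us z] by simp
  then show ?thesis unfolding above_12_def cut_def by blast
qed

lemma cut_imp_above_12: "cut us v w \<Longrightarrow> above_12 us v"
proof -
  assume "cut us v w"
  then obtain a b u where *: "subseq [a, b, u] us" "a < b" "b < v" by (auto simp: cut_def)
  have "subseq [a, b] [a, b, u]" by simp
  then have "subseq [a, b] us" using * by (metis subseq_order.order_trans)
  then show ?thesis using * by (auto simp: above_12_def)
qed

lemma cut_less: "cut us v w \<Longrightarrow> v < w"
  by (auto simp: cut_def)

text \<open>The ways to continue \<open>us\<close> by the values in \<open>V\<close> in which no occurrence of 12453 has its 5 in the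
  continuation. For empty \<open>us\<close> these are the avoiding permutations, and other than avoidance this form
  can be read off one value at a time.\<close>

definition safe_orders :: "nat list \<Rightarrow> nat set \<Rightarrow> nat list set" where
  "safe_orders us V = {ys. distinct ys \<and> set ys = V \<and>
     (\<forall>as w bs v. ys = as @ w # bs \<longrightarrow> v \<in> set bs \<longrightarrow> \<not> cut (us @ as) v w)}"

text \<open>Occurrences with \<open>w\<close> in the role of the 5 are excluded by the second conjunct, the others by the third one.\<close>

lemma safe_orders_Cons:
  "w # ys \<in> safe_orders us V \<longleftrightarrow>
     w \<in> V \<and> (\<forall>v\<in>V. \<not> cut us v w) \<and> ys \<in> safe_orders (us @ [w]) (V - {w})"
  (is "?l \<longleftrightarrow> ?r")
proof
  assume l: ?l
  then have *: "distinct (w # ys)" "set (w # ys) = V"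
    and s: "\<And>as w' bs v. w # ys = as @ w' # bs \<Longrightarrow> v \<in> set bs \<Longrightarrow> \<not> cut (us @ as) v w'"
    by (auto simp: safe_orders_def)
  have "\<not> cut us v w" if "v \<in> V" for v
    using s[of "[]" w ys v] that * cut_less by fastforce
  moreover have "\<not> cut ((us @ [w]) @ as) v w'" if "ys = as @ w' # bs" "v \<in> set bs" for as w' bs v
    using s[of "w # as" w' bs v] that by simp
  ultimately show ?r using * by (auto simp: safe_orders_def)
next
  assume r: ?r
  then have *: "distinct (w # ys)" "set (w # ys) = V" by (auto simp: safe_orders_def)
  have "\<not> cut (us @ as) v w'" if "w # ys = as @ w' # bs" "v \<in> set bs" for as w' bs v
  proof (cases as)
    case Nil
    then show ?thesis using that r * by auto
  next
    case (Cons a as')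
    then show ?thesis using that r by (auto simp: safe_orders_def)
  qed
  then show ?l using * by (auto simp: safe_orders_def)
qed

text \<open>An occurrence of the pattern is split at its 5.\<close>

lemma contains_12453_iff:
  "contains_pattern \<pi> [1, 2, 4, 5, 3] \<longleftrightarrow>
     (\<exists>as w bs v. \<pi> = as @ w # bs \<and> v \<in> set bs \<and> cut as v w)"
proof -
  have iso: "order_isomorphic xs [1, 2, 4, 5, 3] \<longleftrightarrow>
    (\<exists>a b u w v. xs = [a, b, u, w, v] \<and> a < b \<and> b < v \<and> v < u \<and> u < w)" for xs
  proof -
    have len5: "length xs = 5 \<longleftrightarrow> (\<exists>a b u w v. xs = [a, b, u, w, v])"
      by (auto simp: eval_nat_numeral length_Suc_conv)
    show ?thesis
    proof (cases "length xs = 5")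
      case True
      then obtain a b u w v where xs: "xs = [a, b, u, w, v]" using len5 by blast
      show ?thesis by (auto simp: order_isomorphic_def xs All_less_Suc2)
    next
      case False
      then show ?thesis by (auto simp: order_isomorphic_def)
    qed
  qed
  have sub: "subseq [a, b, u, w, v] \<pi> \<longleftrightarrow>
    (\<exists>as bs. \<pi> = as @ w # bs \<and> v \<in> set bs \<and> subseq [a, b, u] as)" for a b u w v
  proof
    assume "subseq [a, b, u, w, v] \<pi>"
    then obtain p1 p2 where p: "\<pi> = p1 @ p2" "subseq [a, b, u] p1" "subseq [w, v] p2"
      using list_emb_appendD[of "(=)" "[a, b, u]" "[w, v]" \<pi>] by auto
    from p(3) obtain c1 c2 where "p2 = c1 @ w # c2" "subseq [v] c2"
      using list_emb_ConsD[of "(=)" w "[v]" p2] by auto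
    then show "\<exists>as bs. \<pi> = as @ w # bs \<and> v \<in> set bs \<and> subseq [a, b, u] as"
      using p by (intro exI[of _ "p1 @ c1"] exI[of _ c2]) (auto simp: subseq_singleton_left subseq_rev_drop_many)
  next
    assume "\<exists>as bs. \<pi> = as @ w # bs \<and> v \<in> set bs \<and> subseq [a, b, u] as"
    then obtain as bs where "\<pi> = as @ w # bs" "v \<in> set bs" "subseq [a, b, u] as" by blast
    then show "subseq [a, b, u, w, v] \<pi>"
      using list_emb_append_mono[of "(=)" "[a,b,u]" as "[w,v]" "w # bs"]
      by (auto simp: subseq_singleton_left)
  qed
  have "contains_pattern \<pi> [1, 2, 4, 5, 3] \<longleftrightarrow>
      (\<exists>a b u w v. subseq [a, b, u, w, v] \<pi> \<and> a < b \<and> b < v \<and> v < u \<and> u < w)"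
    unfolding contains_pattern_def iso by fastforce
  then show ?thesis
    unfolding sub cut_def by fast
qed

lemma Av_eq_safe_orders: "Av n [1, 2, 4, 5, 3] = safe_orders [] {1..n}"
  unfolding Av_def safe_orders_def contains_12453_iff permutations_of_set_def by auto

text \<open>The invariant that connects a written prefix \<open>us\<close> with a state: the remaining values in increasing order,
  cut into the early band, the last band and the blocks counted by the stack. Blocks need only be cut at the
  largest element of the lower one. Writing a value of the last band moves values into the lowest
  block that are not cut from the blocks above, so the condition for all elements would not be preserved.\<close>

definition bands :: "nat list \<Rightarrow> nat list \<Rightarrow> nat list \<Rightarrow> nat list list \<Rightarrow> bool" where
  "bands us E Q Ls \<longleftrightarrow> sorted_wrt (<) (E @ Q @ concat Ls) \<and> [] \<notin> set Ls \<and>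
     (\<forall>v\<in>set E. \<forall>a\<in>set us. v < a) \<and>
     (\<forall>v\<in>set Q. (\<exists>a\<in>set us. a < v) \<and> \<not> above_12 us v) \<and>
     (\<forall>B\<in>set Ls. \<forall>v\<in>set B. above_12 us v \<and> (\<forall>w\<in>set B. \<not> cut us v w)) \<and>
     sorted_wrt (\<lambda>A B. \<forall>w\<in>set B. cut us (last A) w) Ls"

fun state_of :: "nat list \<Rightarrow> nat list \<Rightarrow> nat list list \<Rightarrow> state" where
  "state_of E Q Ls = ((length E, length Q), map length Ls)"

lemma map_length_filter: "map length (filter (\<lambda>B. B \<noteq> []) Ls) = nz (map length Ls)"
  by (induction Ls) (auto simp: nz_def)

lemma concat_filter: "concat (filter (\<lambda>B. B \<noteq> []) Ls) = concat Ls"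
  by (induction Ls) auto

lemma not_above_12_below: "\<forall>a\<in>set us. v \<le> a \<Longrightarrow> \<not> above_12 us v"
proof
  assume a: "\<forall>a\<in>set us. v \<le> a" and "above_12 us v"
  then obtain a b where *: "subseq [a, b] us" "a < b" "b < v" by (auto simp: above_12_def)
  then have "a \<in> set us" using list_emb_set[OF *(1), of a] by auto
  then show False using a * by force
qed

text \<open>A new minimum \<open>z\<close> cannot be the 2 or the 4 of anything, because no written value is smaller. It only
  lifts the larger early values into the last band.\<close>

lemma bands_early:
  assumes "bands us (E1 @ z # E2) Q Ls"
  shows "bands (us @ [z]) E1 (E2 @ Q) Ls"
proof -
  have s: "sorted_wrt (<) ((E1 @ z # E2) @ Q @ concat Ls)"
    and z: "\<forall>a\<in>set us. z < a" and ne: "[] \<notin> set Ls"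
    and E: "\<forall>v\<in>set (E1 @ E2). \<forall>a\<in>set us. v < a"
    and Q: "\<forall>v\<in>set Q. (\<exists>a\<in>set us. a < v) \<and> \<not> above_12 us v"
    and L: "\<forall>B\<in>set Ls. \<forall>v\<in>set B. above_12 us v \<and> (\<forall>w\<in>set B. \<not> cut us v w)"
    and tail: "sorted_wrt (\<lambda>A B. \<forall>w\<in>set B. cut us (last A) w) Ls"
    using assms by (auto simp: bands_def)
  have E2: "\<not> above_12 us v" if "v \<in> set E2" for v
    using that E not_above_12_below by (simp add: less_imp_le)
  have d: "above_12 (us @ [z]) v \<longleftrightarrow> above_12 us v" for v using z by (auto simp: above_12_snoc)
  have gr: "z < v" if "v \<in> set E2 \<or> v \<in> set Q \<or> v \<in> set (concat Ls)" for v
    using s that by (fastforce simp: sorted_wrt_append)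
  have sm: "v < z" if "v \<in> set E1" for v
    using s that by (fastforce simp: sorted_wrt_append)
  have c: "cut (us @ [z]) v w \<longleftrightarrow> cut us v w" if "B \<in> set Ls" "v \<in> set B" for B v w
    using gr[of v] that less_asym unfolding cut_snoc set_concat by blast
  have "sorted_wrt (<) (E1 @ (E2 @ Q) @ concat Ls)" using s by (simp add: sorted_wrt_append)
  moreover have "\<forall>v\<in>set E1. \<forall>a\<in>set (us @ [z]). v < a" using E sm by auto
  moreover have "\<forall>v\<in>set (E2 @ Q). (\<exists>a\<in>set (us @ [z]). a < v) \<and> \<not> above_12 (us @ [z]) v"
    using E2 Q gr d by auto
  moreover have "\<forall>B\<in>set Ls. \<forall>v\<in>set B. above_12 (us @ [z]) v \<and> (\<forall>w\<in>set B. \<not> cut (us @ [z]) v w)"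
    using L c d by blast
  moreover have "sorted_wrt (\<lambda>A B. \<forall>w\<in>set B. cut (us @ [z]) (last A) w) Ls"
    using tail by (rule sorted_wrt_mono_rel[rotated]) (simp add: cut_snoc)
  ultimately show ?thesis using ne unfolding bands_def by blast
qed

text \<open>A value \<open>z\<close> of the last band has a smaller value before it, so every larger value of the band is
  now above an ascent 12. These values join the lowest block; the largest element of this block, which is cut
  from the other blocks, does not change. Since \<open>z\<close> is smaller than all values in the blocks, it cuts none
  of them, and before \<open>z\<close> the joining values were not above an ascent 12, so nothing written can play a 4 for
  them.\<close>

lemma bands_last:
  assumes "bands us E (Q1 @ z # Q2) Ls"
  shows "bands (us @ [z]) E Q1 (filter (\<lambda>B. B \<noteq> []) ((Q2 @ concat (take 1 Ls)) # tl Ls))"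
proof -
  have s: "sorted_wrt (<) (E @ (Q1 @ z # Q2) @ concat Ls)"
    and z: "\<exists>a\<in>set us. a < z" and nd: "\<forall>v\<in>set (Q1 @ z # Q2). \<not> above_12 us v"
    and ne: "[] \<notin> set Ls" using assms by (auto simp: bands_def)
  have d: "above_12 (us @ [z]) v \<longleftrightarrow> above_12 us v \<or> z < v" for v using z by (auto simp: above_12_snoc)
  have c: "cut (us @ [z]) v w \<longleftrightarrow> cut us v w" if "v < z \<longrightarrow> \<not> above_12 us v" for v w
    using that by (auto simp: cut_snoc)
  have above: "z < v" if "v \<in> set Q2 \<or> (\<exists>B\<in>set Ls. v \<in> set B)" for v
    using s that by (fastforce simp: sorted_wrt_append)
  have below: "v < z" if "v \<in> set E \<or> v \<in> set Q1" for v
    using s that by (fastforce simp: sorted_wrt_append)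
  have E: "\<forall>v\<in>set E. \<forall>a\<in>set (us @ [z]). v < a" using assms below by (auto simp: bands_def)
  have below': "\<not> z < v" if "v \<in> set Q1" for v using below that by (meson less_asym)
  have Q1: "\<forall>v\<in>set Q1. (\<exists>a\<in>set (us @ [z]). a < v) \<and> \<not> above_12 (us @ [z]) v"
    using assms below' unfolding d by (auto simp: bands_def)
  have Q2: "\<not> cut (us @ [z]) v w" if "v \<in> set Q2" for v w
  proof -
    have "\<not> above_12 us v" using nd that by simp
    then show ?thesis using c cut_imp_above_12 by blast
  qed
  have up: "above_12 (us @ [z]) v" if "v \<in> set Q2 \<or> (\<exists>B\<in>set Ls. v \<in> set B)" for v
    using d above that by blast
  show ?thesis
  proof (cases Ls)
    case Nil
    have "sorted_wrt (<) (E @ Q1 @ Q2)" using s Nil by (simp add: sorted_wrt_append)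
    then show ?thesis using E Q1 Q2 up Nil unfolding bands_def by (cases "Q2 = []") simp_all
  next
    case (Cons B Bs)
    have B: "B \<noteq> []" "B \<in> set Ls" using Cons ne by auto
    \<comment> \<open>The band lies below the block, and a value is never cut from a smaller one.\<close>
    have Q2': "\<not> cut (us @ [z]) v w" if "w \<in> set Q2" "v \<in> set B" for v w
    proof -
      have "w < v" using that s Cons by (auto simp: sorted_wrt_append)
      then show ?thesis using cut_less by (metis less_asym)
    qed
    have c': "cut (us @ [z]) v w \<longleftrightarrow> cut us v w" if "B' \<in> set Ls" "v \<in> set B'" for v w B'
      using c above that by (metis less_asym)
    have last: "cut (us @ [z]) (last B') w \<longleftrightarrow> cut us (last B') w" if "B' \<in> set Ls" for w B'
      using c' that ne by (metis last_in_set)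
    have inner: "\<forall>B'\<in>set ((Q2 @ B) # Bs). \<forall>v\<in>set B'. above_12 (us @ [z]) v \<and> (\<forall>w\<in>set B'. \<not> cut (us @ [z]) v w)"
    proof -
      have "\<not> cut (us @ [z]) v w" if "B' \<in> set Ls" "v \<in> set B'" "w \<in> set B'" for B' v w
        using c' that assms by (auto simp: bands_def)
      moreover have "above_12 (us @ [z]) v" if "B' \<in> set ((Q2 @ B) # Bs)" "v \<in> set B'" for B' v
        using that up[of v] Cons by auto
      ultimately show ?thesis using Q2 Q2' Cons by auto
    qed
    have "sorted_wrt (\<lambda>A B. \<forall>w\<in>set B. cut us (last A) w) Ls" using assms by (auto simp: bands_def)
    then have "sorted_wrt (\<lambda>A B. \<forall>w\<in>set B. cut (us @ [z]) (last A) w) Ls"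
      by (rule sorted_wrt_mono_rel[rotated]) (use last in auto)
    then have outer: "sorted_wrt (\<lambda>A B. \<forall>w\<in>set B. cut (us @ [z]) (last A) w) ((Q2 @ B) # Bs)"
      using Cons B by simp
    have "filter (\<lambda>B. B \<noteq> []) ((Q2 @ concat (take 1 Ls)) # tl Ls) = (Q2 @ B) # Bs"
      using Cons ne by (auto simp: filter_id_conv)
    moreover have "sorted_wrt (<) (E @ Q1 @ concat ((Q2 @ B) # Bs))"
      using s Cons by (simp add: sorted_wrt_append)
    ultimately show ?thesis using inner outer ne Cons B E Q1
      unfolding bands_def by simp
  qed
qed

text \<open>A value \<open>z\<close> of the lowest block is above an ascent 12 and hence plays a 4: it cuts the smaller
  elements of its block from all larger values. The upper part keeps its largest element and so remains cut
  from the other blocks.\<close>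

lemma bands_head:
  assumes "bands us E Q ((A1 @ z # A2) # Ls)"
  shows "bands (us @ [z]) E Q (filter (\<lambda>B. B \<noteq> []) (A1 # A2 # Ls))"
proof -
  have s: "sorted_wrt (<) (E @ Q @ concat ((A1 @ z # A2) # Ls))"
    and dz: "above_12 us z" and ne: "[] \<notin> set Ls"
    and nc: "\<forall>v\<in>set (A1 @ A2). \<forall>w\<in>set (A1 @ A2). \<not> cut us v w"
    and d0: "\<forall>v\<in>set (A1 @ A2) \<union> set (concat Ls). above_12 us v"
    and nc': "\<forall>B\<in>set Ls. \<forall>v\<in>set B. \<forall>w\<in>set B. \<not> cut us v w"
    and last0: "\<forall>w\<in>set (concat Ls). cut us (last (z # A2)) w"
    and tail: "sorted_wrt (\<lambda>A B. \<forall>w\<in>set B. cut us (last A) w) Ls"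
    using assms by (auto simp: bands_def split: if_splits)
  obtain a where az: "a \<in> set us" "a < z"
    using not_above_12_below[of us z] dz by (meson not_le)
  have sm: "v < z" if "v \<in> set E \<or> v \<in> set Q \<or> v \<in> set A1" for v
    using s that by (fastforce simp: sorted_wrt_append)
  have gr: "z < v" if "v \<in> set A2 \<or> v \<in> set (concat Ls)" for v
    using s that by (fastforce simp: sorted_wrt_append)
  have mono: "cut us v w \<Longrightarrow> cut (us @ [z]) v w" for v w by (simp add: cut_snoc)
  have "sorted_wrt (<) (E @ Q @ concat (filter (\<lambda>B. B \<noteq> []) (A1 # A2 # Ls)))"
    using s unfolding concat_filter by (auto simp: sorted_wrt_append)
  moreover have "\<forall>v\<in>set E. \<forall>a\<in>set (us @ [z]). v < a" using assms sm by (auto simp: bands_def)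
  moreover have "\<forall>v\<in>set Q. (\<exists>a\<in>set (us @ [z]). a < v) \<and> \<not> above_12 (us @ [z]) v"
    using assms sm by (fastforce simp: bands_def above_12_snoc)
  moreover have "above_12 (us @ [z]) v" if "B \<in> set (A1 # A2 # Ls)" "v \<in> set B" for B v
    using d0 that by (auto simp: above_12_snoc)
  moreover have "\<not> cut (us @ [z]) v w" if "B \<in> set (A1 # A2 # Ls)" "v \<in> set B" "w \<in> set B" for B v w
  proof -
    have "\<not> (v < z \<and> z < w)"
      using that sm gr by (auto dest: less_asym)
    moreover have "\<not> cut us v w" using that nc nc' by auto
    ultimately show ?thesis by (simp add: cut_snoc)
  qed
  moreover have "sorted_wrt (\<lambda>A B. \<forall>w\<in>set B. cut (us @ [z]) (last A) w) (filter (\<lambda>B. B \<noteq> []) (A1 # A2 # Ls))"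
  proof -
    have "sorted_wrt (\<lambda>A B. \<forall>w\<in>set B. cut (us @ [z]) (last A) w) Ls"
      using tail by (rule sorted_wrt_mono_rel[rotated]) (use mono in auto)
    moreover have "filter (\<lambda>B. B \<noteq> []) Ls = Ls" using ne by (auto simp: filter_id_conv)
    moreover have "cut (us @ [z]) (last A2) w" if "A2 \<noteq> []" "w \<in> set (concat Ls)" for w
      using that last0 mono by auto
    moreover have "cut (us @ [z]) (last A1) w" if "A1 \<noteq> []" "w \<in> set A2 \<or> w \<in> set (concat Ls)" for w
      using that sm[of "last A1"] gr[of w] d0 by (auto simp: cut_snoc)
    ultimately show ?thesis by (cases "A1 = []"; cases "A2 = []"; simp; blast)
  qed
  moreover have "[] \<notin> set (filter (\<lambda>B. B \<noteq> []) (A1 # A2 # Ls))" by simp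
  moreover have "set (filter (\<lambda>B. B \<noteq> []) (A1 # A2 # Ls)) \<subseteq> set (A1 # A2 # Ls)" by auto
  ultimately show ?thesis unfolding bands_def by blast
qed

text \<open>The values that may be written next are exactly those up to the end of the lowest block: the largest
  element of that block is cut from everything above.\<close>

lemma bands_active:
  assumes "bands us E Q Ls" and "x < length (E @ Q @ concat Ls)"
  shows "(\<forall>v\<in>set (E @ Q @ concat Ls). \<not> cut us v ((E @ Q @ concat Ls) ! x)) \<longleftrightarrow> x < room (state_of E Q Ls)"
proof -
  let ?vs = "E @ Q @ concat Ls"
  have low: "\<not> cut us v w" if "v \<in> set E \<union> set Q" for v w
  proof -
    have "\<not> above_12 us v"
      using that assms(1) not_above_12_below[of us v] by (auto simp: bands_def intro: less_imp_le)
    then show ?thesis using cut_imp_above_12 by blast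
  qed
  have srt: "sorted_wrt (<) ?vs" using assms(1) by (simp add: bands_def)
  show ?thesis
  proof (cases Ls)
    case Nil
    then show ?thesis using assms(2) low by auto
  next
    case (Cons B Bs)
    have B: "B \<noteq> []" "last B \<in> set ?vs" using assms(1) Cons by (auto simp: bands_def)
    have lB: "cut us (last B) w" if "w \<in> set (concat Bs)" for w
      using that assms(1) Cons by (auto simp: bands_def)
    have nB: "\<not> cut us v w" if "v \<in> set B" "w \<in> set B" for v w
      using that assms(1) Cons by (auto simp: bands_def)
    show ?thesis
    proof (cases "x < room (state_of E Q Ls)")
      case True
      have "\<not> cut us v (?vs ! x)" if v: "v \<in> set ?vs" for v
      proof (cases "v \<in> set E \<union> set Q")
        case False
        then obtain k where k: "k < length (concat Ls)" "v = concat Ls ! k"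
          using v by (auto simp: in_set_conv_nth simp del: set_concat)
        then have k': "v = ?vs ! (length E + length Q + k)" by (simp add: nth_append)
        show ?thesis
        proof (cases "x < length E + length Q + k")
          case True
          then have "?vs ! x < v" unfolding k' by (intro sorted_wrt_nth_less[OF srt]) (use k in auto)
          then show ?thesis using cut_less by (metis less_asym)
        next
          case False
          then have "v \<in> set B" "?vs ! x \<in> set B" using True k Cons by (auto simp: nth_append)
          then show ?thesis using nB by blast
        qed
      qed (use low in blast)
      then show ?thesis using True by blast
    next
      case False
      then have "?vs ! x = concat Bs ! (x - length E - length Q - length B)"
        "x - length E - length Q - length B < length (concat Bs)"
        using assms(2) Cons by (auto simp: nth_append)
      then have "?vs ! x \<in> set (concat Bs)" by (metis nth_mem)
      then show ?thesis using lB B False by blast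
    qed
  qed
qed

lemma nz_second_zero: "nz (i # 0 # L) = nz (i # L)"
  by (simp add: nz_def)

lemma bands_step:
  assumes b: "bands us E Q Ls" and x: "x < room (state_of E Q Ls)"
  defines "vs \<equiv> E @ Q @ concat Ls"
  shows "\<exists>E' Q' Ls'. bands (us @ [vs ! x]) E' Q' Ls' \<and>
    E' @ Q' @ concat Ls' = take x vs @ drop (Suc x) vs \<and>
    state_of E' Q' Ls' = step (state_of E Q Ls) x"
proof -
  consider "x < length E" | "\<not> x < length E" "x < length E + length Q" | "\<not> x < length E + length Q" by linarith
  then show ?thesis
  proof cases
    case 1
    then have E: "E = take x E @ vs ! x # drop (Suc x) E"
      by (simp add: vs_def nth_append id_take_nth_drop)
    have nz: "nz (map length Ls) = map length Ls"
      using b by (intro nz_id) (auto simp: bands_def)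
    have "bands (us @ [vs ! x]) (take x E) (drop (Suc x) E @ Q) Ls"
      by (rule bands_early) (use b E in simp)
    moreover have "state_of (take x E) (drop (Suc x) E @ Q) Ls = step (state_of E Q Ls) x"
      using 1 nz by (cases Ls) (auto simp: nz_def split: if_splits)
    ultimately show ?thesis
      using 1 by (intro exI[of _ "take x E"] exI[of _ "drop (Suc x) E @ Q"] exI[of _ Ls]) (simp add: vs_def)
  next
    case 2
    define h where "h = x - length E"
    have h: "x = length E + h" "h < length Q" using 2 by (auto simp: h_def)
    then have Q: "Q = take h Q @ vs ! x # drop (Suc h) Q"
      by (simp add: vs_def nth_append id_take_nth_drop)
    let ?Ls = "filter (\<lambda>B. B \<noteq> []) ((drop (Suc h) Q @ concat (take 1 Ls)) # tl Ls)"
    have "bands (us @ [vs ! x]) E (take h Q) ?Ls"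
      by (rule bands_last) (use b Q in simp)
    moreover have "state_of E (take h Q) ?Ls = step (state_of E Q Ls) x"
      unfolding state_of.simps map_length_filter using h
      by (cases Ls) (simp_all add: nz_second_zero add.commute)
    moreover have "concat ?Ls = drop (Suc h) Q @ concat Ls"
      unfolding concat_filter by (cases Ls) auto
    ultimately show ?thesis
      using h by (intro exI[of _ E] exI[of _ "take h Q"] exI[of _ ?Ls]) (simp add: vs_def)
  next
    case 3
    define h where "h = x - length E - length Q"
    from 3 x obtain B Bs where Ls: "Ls = B # Bs" by (cases Ls) auto
    have h: "x = length E + length Q + h" "h < length B" using 3 x Ls by (auto simp: h_def)
    then have B: "B = take h B @ vs ! x # drop (Suc h) B"
      by (simp add: vs_def nth_append id_take_nth_drop Ls)
    let ?Ls = "filter (\<lambda>B. B \<noteq> []) (take h B # drop (Suc h) B # Bs)"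
    have "bands (us @ [vs ! x]) E Q ?Ls"
      by (rule bands_head) (use b B Ls in simp)
    moreover have "state_of E Q ?Ls = step (state_of E Q Ls) x"
      using h Ls by (simp add: map_length_filter nz_def)
    moreover have "concat ?Ls = take h B @ drop (Suc h) B @ concat Bs"
      unfolding concat_filter by simp
    ultimately show ?thesis
      using h Ls by (intro exI[of _ E] exI[of _ Q] exI[of _ ?Ls]) (simp add: vs_def)
  qed
qed

lemma set_delete_nth:
  assumes "distinct vs" "x < length vs"
  shows "set (take x vs @ drop (Suc x) vs) = set vs - {vs ! x}"
proof -
  have "vs = take x vs @ vs ! x # drop (Suc x) vs" using assms(2) by (rule id_take_nth_drop)
  then have "distinct (take x vs @ vs ! x # drop (Suc x) vs)"
    "set vs = set (take x vs @ vs ! x # drop (Suc x) vs)" using assms(1) by metis+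
  then show ?thesis by auto
qed

lemma room_le_length: "room (state_of E Q Ls) \<le> length (E @ Q @ concat Ls)"
  by (cases Ls) auto

lemma decode_in_safe_orders:
  assumes "bands us E Q Ls" "complete (state_of E Q Ls) xs"
  shows "decode (E @ Q @ concat Ls) xs \<in> safe_orders us (set (E @ Q @ concat Ls))"
  using assms
proof (induction xs arbitrary: us E Q Ls)
  case Nil
  then have "E = []" "Q = []" "Ls = []" by (cases Ls; auto simp: bands_def)+
  then show ?case by (auto simp: safe_orders_def)
next
  case (Cons x xs)
  define vs where "vs = E @ Q @ concat Ls"
  have x: "x < room (state_of E Q Ls)" and xs: "complete (step (state_of E Q Ls) x) xs"
    using Cons.prems by auto
  have xl: "x < length vs" using x room_le_length[of E Q Ls] by (simp add: vs_def)
  obtain E' Q' Ls' where *: "bands (us @ [vs ! x]) E' Q' Ls'"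
    "E' @ Q' @ concat Ls' = take x vs @ drop (Suc x) vs"
    "state_of E' Q' Ls' = step (state_of E Q Ls) x"
    using bands_step[OF Cons.prems(1) x] unfolding vs_def by blast
  have IH: "decode (take x vs @ drop (Suc x) vs) xs \<in> safe_orders (us @ [vs ! x]) (set (take x vs @ drop (Suc x) vs))"
    using Cons.IH[OF *(1)] xs * by simp
  have "distinct vs" using Cons.prems(1) unfolding bands_def vs_def strict_sorted_iff by blast
  then have "set (take x vs @ drop (Suc x) vs) = set vs - {vs ! x}"
    using xl by (rule set_delete_nth)
  moreover have "\<forall>v\<in>set vs. \<not> cut us v (vs ! x)"
    using bands_active[OF Cons.prems(1)] x xl unfolding vs_def by blast
  ultimately show ?case
    using IH xl unfolding vs_def[symmetric] by (simp add: safe_orders_Cons)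
qed

lemma inj_on_decode:
  assumes "bands us E Q Ls" "complete (state_of E Q Ls) xs" "complete (state_of E Q Ls) ys"
    "decode (E @ Q @ concat Ls) xs = decode (E @ Q @ concat Ls) ys"
  shows "xs = ys"
  using assms
proof (induction xs arbitrary: ys us E Q Ls)
  case Nil
  then show ?case by (cases ys) auto
next
  case (Cons x xs)
  define vs where "vs = E @ Q @ concat Ls"
  obtain y ys' where ys: "ys = y # ys'" using Cons.prems by (cases ys) auto
  have x: "x < room (state_of E Q Ls)" "y < room (state_of E Q Ls)"
    using Cons.prems ys by auto
  then have xl: "x < length vs" "y < length vs" using room_le_length[of E Q Ls] by (auto simp: vs_def)
  have "distinct vs" using Cons.prems(1) unfolding bands_def vs_def strict_sorted_iff by blast
  moreover have "vs ! x = vs ! y" using Cons.prems(4) ys by (simp add: vs_def)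
  ultimately have xy: "x = y" using xl by (simp add: nth_eq_iff_index_eq)
  obtain E' Q' Ls' where *: "bands (us @ [vs ! x]) E' Q' Ls'"
    "E' @ Q' @ concat Ls' = take x vs @ drop (Suc x) vs"
    "state_of E' Q' Ls' = step (state_of E Q Ls) x"
    using bands_step[OF Cons.prems(1) x(1)] unfolding vs_def by blast
  have "xs = ys'"
    by (rule Cons.IH[OF *(1)]) (use Cons.prems ys xy in \<open>simp_all only: *(2,3) vs_def decode.simps complete.simps list.inject\<close>)
  then show ?case using ys xy by simp
qed

lemma safe_orders_decode:
  assumes "bands us E Q Ls" "zs \<in> safe_orders us (set (E @ Q @ concat Ls))"
  shows "\<exists>xs. complete (state_of E Q Ls) xs \<and> zs = decode (E @ Q @ concat Ls) xs"
  using assms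
proof (induction zs arbitrary: us E Q Ls)
  case Nil
  then have "set (E @ Q @ concat Ls) = {}" by (simp add: safe_orders_def)
  then have "Ls = []" "E = []" "Q = []" using Nil.prems(1) by (auto simp: bands_def) (cases Ls; auto)
  then show ?case by (intro exI[of _ "[]"]) auto
next
  case (Cons z zs)
  define vs where "vs = E @ Q @ concat Ls"
  have zs: "z \<in> set vs" "\<forall>v\<in>set vs. \<not> cut us v z" "zs \<in> safe_orders (us @ [z]) (set vs - {z})"
    using Cons.prems(2) unfolding vs_def[symmetric] safe_orders_Cons by auto
  then obtain x where xl: "x < length vs" and z: "z = vs ! x" by (auto simp: in_set_conv_nth)
  have x: "x < room (state_of E Q Ls)"
    using bands_active[OF Cons.prems(1)] zs(2) xl z unfolding vs_def by blast
  obtain E' Q' Ls' where *: "bands (us @ [vs ! x]) E' Q' Ls'"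
    "E' @ Q' @ concat Ls' = take x vs @ drop (Suc x) vs"
    "state_of E' Q' Ls' = step (state_of E Q Ls) x"
    using bands_step[OF Cons.prems(1) x] unfolding vs_def by blast
  have "distinct vs" using Cons.prems(1) unfolding bands_def vs_def strict_sorted_iff by blast
  then have "set (take x vs @ drop (Suc x) vs) = set vs - {vs ! x}"
    using xl by (rule set_delete_nth)
  then have "zs \<in> safe_orders (us @ [vs ! x]) (set (E' @ Q' @ concat Ls'))"
    using zs(3) z *(2) by simp
  from Cons.IH[OF *(1) this] obtain xs where
    "complete (state_of E' Q' Ls') xs" "zs = decode (E' @ Q' @ concat Ls') xs" by blast
  then show ?case using x z *(2,3)
    by (intro exI[of _ "x # xs"]) (simp add: vs_def)
qed

text \<open>At each step the legal ranks are the indices of the transitions, and the invariant passes to the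
  shortened list.\<close>

lemma bij_betw_decode:
  "bij_betw (decode [1..<Suc n]) {xs. complete ((n, 0), []) xs} (Av n [1, 2, 4, 5, 3])"
proof -
  have b: "bands [] [1..<Suc n] [] []" by (simp add: bands_def del: upt_Suc)
  have s: "state_of [1..<Suc n] [] [] = ((n, 0), [])" by simp
  show ?thesis unfolding Av_eq_safe_orders
    using decode_in_safe_orders[OF b] inj_on_decode[OF b] safe_orders_decode[OF b]
    unfolding s by (intro bij_betw_imageI inj_onI) (auto simp: atLeastLessThanSuc_atLeastAtMost image_iff simp del: upt_Suc)
qed

section \<open>Codes and the tabulated numbers\<close>

text \<open>The codes of the paths from \<open>S\<close> that end at control \<open>cs\<close> at the first moment when the stack is
  empty.\<close>

fun stopped :: "state \<Rightarrow> control \<Rightarrow> nat list \<Rightarrow> bool" where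
  "stopped S cs [] \<longleftrightarrow> S = (cs, [])"
| "stopped S cs (x # xs) \<longleftrightarrow> snd S \<noteq> [] \<and> x < room S \<and> stopped (step S x) cs xs"

fun move_at :: "control \<Rightarrow> nat \<Rightarrow> nat \<Rightarrow> move" where
  "move_at (p, q) l x =
    (if x < p then Early x else if x < p + q then Last (x - p)
     else Head (x - p - q) (l - 1 - (x - p - q)))"

fun moves :: "state \<Rightarrow> nat list \<Rightarrow> move list" where
  "moves S [] = []"
| "moves S (x # xs) = move_at (fst S) (head0 (snd S)) x # moves (step S x) xs"

lemma inj_move_at: "move_at pq l x = move_at pq l y \<Longrightarrow> x = y"
  by (cases pq) (auto split: if_splits)

lemma zero_free_step: "0 \<notin> set (snd (step S x))"
  by (cases S) (auto simp: split: prod.splits)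

text \<open>The index determines the transition and conversely, so paths can be replaced by their codes.\<close>

lemma transition_iff_step:
  assumes "0 \<notin> set (snd S)"
  shows "transition S m T \<longleftrightarrow> (\<exists>x<room S. m = move_at (fst S) (head0 (snd S)) x \<and> T = step S x)"
  (is "?l \<longleftrightarrow> ?r")
proof
  assume ?l
  then show ?r using assms
  proof cases
    case (early h p q L)
    then show ?thesis using assms
      by (intro exI[of _ h]) (cases L; auto simp: nz_id nz_second_zero)
  next
    case (last_empty h q p)
    then show ?thesis by (intro exI[of _ "p + h"]) (auto simp: nz_second_zero)
  next
    case (last_Cons h q p l L)
    then show ?thesis by (intro exI[of _ "p + h"]) (auto simp: nz_second_zero)
  next
    case (head i j l p q L)
    then show ?thesis by (intro exI[of _ "p + q + i"]) auto
  qed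
next
  assume ?r
  then obtain x where x: "x < room S" and m: "m = move_at (fst S) (head0 (snd S)) x" and T: "T = step S x"
    by blast
  obtain p q L where S: "S = ((p, q), L)" by (metis surj_pair)
  consider "x < p" | "\<not> x < p" "x < p + q" | "\<not> x < p + q" by linarith
  then show ?l
  proof cases
    case 1
    have "nz (head0 L # 0 # tl L) = L" using assms S by (cases L) (auto simp: nz_id)
    then show ?thesis using 1 m T S transition.early[of x p q L] by (simp add: add.commute)
  next
    case 2
    show ?thesis
    proof (cases L)
      case Nil
      then show ?thesis using 2 m T S transition.last_empty[of "x - p" q p] by (auto simp: nz_second_zero)
    next
      case (Cons l L')
      then show ?thesis using 2 m T S transition.last_Cons[of "x - p" q p l L'] by (auto simp: nz_second_zero)
    qed
  next
    case 3
    then obtain l L' where "L = l # L'" using x S by (cases L) auto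
    then show ?thesis using 3 x m T S transition.head[of "x - p - q" "l - 1 - (x - p - q)" l p q L'] by auto
  qed
qed

lemma maximal_paths_Nil: "0 \<notin> set (snd S) \<Longrightarrow> [] \<in> maximal_paths S \<longleftrightarrow> room S = 0"
proof -
  assume S: "0 \<notin> set (snd S)"
  have "[] \<in> maximal_paths S \<longleftrightarrow> (\<nexists>m T. transition S m T)"
    unfolding maximal_paths_def mem_Collect_eq path_simps by blast
  also have "\<dots> \<longleftrightarrow> \<not> 0 < room S" unfolding transition_iff_step[OF S]
    by (auto simp del: room.simps step.simps split_paired_Ex split_paired_All)
  finally show ?thesis by simp
qed

lemma maximal_paths_Cons: "m # ms \<in> maximal_paths S \<longleftrightarrow> (\<exists>T. transition S m T \<and> ms \<in> maximal_paths T)"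
  unfolding maximal_paths_def mem_Collect_eq path_simps by blast

lemma maximal_paths_eq_moves:
  assumes "0 \<notin> set (snd S)"
  shows "maximal_paths S = moves S ` {xs. complete S xs}"
proof -
  have "ms \<in> maximal_paths S \<longleftrightarrow> (\<exists>xs. complete S xs \<and> ms = moves S xs)" for ms
    using assms
  proof (induction ms arbitrary: S)
    case Nil
    have "(\<exists>xs. complete S xs \<and> [] = moves S xs) \<longleftrightarrow> complete S []"
      by (metis list.distinct(1) list.exhaust moves.simps)
    then show ?case using maximal_paths_Nil[OF Nil] by simp
  next
    case (Cons m ms)
    have "m # ms \<in> maximal_paths S \<longleftrightarrow>
      (\<exists>x<room S. m = move_at (fst S) (head0 (snd S)) x \<and> ms \<in> maximal_paths (step S x))"
      unfolding maximal_paths_Cons transition_iff_step[OF Cons.prems] by blast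
    also have "\<dots> \<longleftrightarrow> (\<exists>x<room S. m = move_at (fst S) (head0 (snd S)) x \<and>
         (\<exists>xs. complete (step S x) xs \<and> ms = moves (step S x) xs))"
      using Cons.IH[OF zero_free_step] by blast
    also have "\<dots> \<longleftrightarrow> (\<exists>x xs. complete S (x # xs) \<and> m # ms = moves S (x # xs))"
      by auto
    also have "\<dots> \<longleftrightarrow> (\<exists>xs. complete S xs \<and> m # ms = moves S xs)"
      by (metis list.distinct(1) list.exhaust moves.simps(1))
    finally show ?case .
  qed
  then show ?thesis by blast
qed

lemma moves_eqD: "moves S xs = moves S ys \<Longrightarrow> xs = ys"
proof (induction xs arbitrary: S ys)
  case (Cons x xs)
  then obtain y ys' where ys: "ys = y # ys'" by (cases ys) auto
  then have "x = y" using Cons.prems inj_move_at[of "fst S" "head0 (snd S)" x y] by simp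
  then show ?case using Cons ys by simp
qed (metis list.distinct(1) list.exhaust moves.simps)

lemma G_eq_card: "G pq = card {xs. complete (pq, []) xs}"
  unfolding G_def by (subst maximal_paths_eq_moves) (auto intro!: card_image inj_onI dest: moves_eqD)

lemma stopped_paths_eq_moves:
  assumes "0 \<notin> set L"
  shows "path (pq, L) ms (cs, []) \<and> (\<forall>k<length ms. \<forall>T. path (pq, L) (take k ms) T \<longrightarrow> snd T \<noteq> [])
    \<longleftrightarrow> (\<exists>xs. stopped (pq, L) cs xs \<and> ms = moves (pq, L) xs)"
  using assms
proof (induction ms arbitrary: pq L)
  case Nil
  have "(\<exists>xs. stopped (pq, L) cs xs \<and> [] = moves (pq, L) xs) \<longleftrightarrow> stopped (pq, L) cs []"
    by (metis list.distinct(1) list.exhaust moves.simps)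
  then show ?case by (auto simp: path_simps)
next
  case (Cons m ms)
  let ?S = "(pq, L)"
  define P where "P = (\<lambda>S ms. path S ms (cs, []) \<and> (\<forall>k<length ms. \<forall>T. path S (take k ms) T \<longrightarrow> snd T \<noteq> []))"
  have IH: "P S ms \<longleftrightarrow> (\<exists>xs. stopped S cs xs \<and> ms = moves S xs)" if "0 \<notin> set (snd S)" for S
    using Cons.IH[of "snd S" "fst S"] that unfolding P_def by simp
  have "P ?S (m # ms) \<longleftrightarrow> L \<noteq> [] \<and> (\<exists>T. transition ?S m T \<and> P T ms)"
  proof -
    have "(\<forall>k<length (m # ms). \<forall>T. path ?S (take k (m # ms)) T \<longrightarrow> snd T \<noteq> []) \<longleftrightarrow>
       L \<noteq> [] \<and> (\<forall>U. transition ?S m U \<longrightarrow> (\<forall>k<length ms. \<forall>T. path U (take k ms) T \<longrightarrow> snd T \<noteq> []))"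
      by (simp only: list.size add_Suc_right add_0_right All_less_Suc2 take_0 take_Suc_Cons path_simps)
        (simp, blast)
    then show ?thesis
      unfolding P_def path_simps using transition_deterministic by blast
  qed
  also have "\<dots> \<longleftrightarrow> L \<noteq> [] \<and> (\<exists>x<room ?S. m = move_at pq (head0 L) x \<and> P (step ?S x) ms)"
    using Cons.prems by (auto simp: transition_iff_step simp del: room.simps step.simps split_paired_Ex split_paired_All)
  also have "\<dots> \<longleftrightarrow> (\<exists>x xs. stopped ?S cs (x # xs) \<and> m # ms = moves ?S (x # xs))"
    unfolding IH[OF zero_free_step] by auto
  also have "\<dots> \<longleftrightarrow> (\<exists>xs. stopped ?S cs xs \<and> m # ms = moves ?S xs)"
    by (metis list.distinct(1) list.exhaust moves.simps(1))
  finally show ?case unfolding P_def .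
qed

text \<open>The numbers \<open>K\<close> extended to length 0, where nothing has to be used up.\<close>

definition Kz :: "nat \<Rightarrow> control \<Rightarrow> control \<Rightarrow> nat" where
  "Kz l pq cs = card {xs. stopped (pq, nz [l]) cs xs}"

lemma Kz_eq_K: "1 \<le> l \<Longrightarrow> Kz l pq cs = K l pq cs"
proof -
  assume "1 \<le> l"
  then have "stopped_paths [] l pq cs = moves (pq, [l]) ` {xs. stopped (pq, [l]) cs xs}"
    using stopped_paths_eq_moves[of "[l]" pq _ cs] unfolding stopped_paths_def by auto
  moreover have "inj_on (moves (pq, [l])) X" for X by (auto intro: inj_onI dest: moves_eqD)
  ultimately show ?thesis using \<open>1 \<le> l\<close> by (simp add: Kz_def K_def card_image)
qed

lemma stopped_Nil: "stopped (pq, []) cs xs \<longleftrightarrow> xs = [] \<and> pq = cs"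
  by (cases xs) auto

lemma Kz_0: "Kz 0 pq cs = (if pq = cs then 1 else 0)"
  by (auto simp: Kz_def stopped_Nil)

text \<open>A path that ends with first coordinate \<open>c\<close> never goes below \<open>c\<close>, as the first coordinate only
  decreases. The \<open>c\<close> smallest values are therefore never chosen, and removing them shifts all indices
  by \<open>c\<close>.\<close>

lemma stopped_shift_first:
  "stopped ((p + c, q), L) (c, s) xs \<longleftrightarrow> (\<exists>ys. xs = map ((+) c) ys \<and> stopped ((p, q), L) (0, s) ys)"
proof (induction xs arbitrary: p q L)
  case Nil
  then show ?case by auto
next
  case (Cons x xs)
  \<comment> \<open>Once the first coordinate is below \<open>c\<close>, it stays there.\<close>
  have low: "\<not> stopped ((a, b), M) (c, s) ys" if "a < c" for a b M ys
    using that
  proof (induction ys arbitrary: a b M)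
    case (Cons y ys)
    then show ?case by (cases "y < a") auto
  qed auto
  have ex: "(\<exists>ys. x # xs = map ((+) c) ys \<and> stopped ((p, q), L) (0, s) ys) \<longleftrightarrow>
    (\<exists>y ys. x = c + y \<and> xs = map ((+) c) ys \<and> stopped ((p, q), L) (0, s) (y # ys))"
    unfolding Cons_eq_map_conv by blast
  show ?case
  proof (cases "x < c")
    case True
    then show ?thesis unfolding ex using low[of x] by auto
  next
    case False
    then obtain y where y: "x = c + y" using le_Suc_ex by (metis not_less)
    have "step ((p + c, q), L) x = (case step ((p, q), L) y of ((p', q'), M) \<Rightarrow> ((p' + c, q'), M))"
      using y by (auto simp: add.commute)
    moreover obtain p' q' M where "step ((p, q), L) y = ((p', q'), M)" by (metis surj_pair)
    ultimately show ?thesis unfolding ex using Cons.IH[of p' q' M] y by auto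
  qed
qed

text \<open>\<open>p + q\<close> never increases, and each move that lowers \<open>p\<close> lowers it. So the
  entries that are left out of the table within its size bound are 0.\<close>

lemma stopped_bounds: "stopped ((p, q), L) (c, s) xs \<Longrightarrow> c \<le> p \<and> c + s \<le> p + q \<and> (c < p \<longrightarrow> c + s < p + q)"
proof (induction xs arbitrary: p q L)
  case (Cons x xs)
  then obtain p' q' M where *: "step ((p, q), L) x = ((p', q'), M)" by (metis surj_pair)
  then have "c \<le> p' \<and> c + s \<le> p' + q' \<and> (c < p' \<longrightarrow> c + s < p' + q')"
    using Cons.IH[of p' q' M] Cons.prems by simp
  then show ?case using * by (auto split: if_splits)
qed auto

text \<open>This is why the table of the first-coordinate quotient suffices.\<close>

lemma Kz_eq_R: "1 \<le> l \<Longrightarrow> Kz l (p, q) (c, s) = (if c \<le> p then R l (p - c) q s else 0)"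
proof (cases "c \<le> p")
  case True
  assume l: "1 \<le> l"
  have "{xs. stopped ((p - c + c, q), [l]) (c, s) xs} = map ((+) c) ` {ys. stopped ((p - c, q), [l]) (0, s) ys}"
    unfolding stopped_shift_first by auto
  then have "card {xs. stopped ((p - c + c, q), [l]) (c, s) xs} = card {ys. stopped ((p - c, q), [l]) (0, s) ys}"
    by (simp add: card_image inj_on_def)
  then show ?thesis using True l Kz_eq_K[OF l, of "(p - c, q)" "(0, s)"] by (simp add: R_def Kz_def)
next
  case False
  then have "{xs. stopped ((p, q), nz [l]) (c, s) xs} = {}" using stopped_bounds by blast
  then show ?thesis using False by (simp add: Kz_def)
qed

lemma Kz_eq_0: "\<not> (c \<le> p \<and> c + s \<le> p + q \<and> (c < p \<longrightarrow> c + s < p + q)) \<Longrightarrow> Kz l (p, q) (c, s) = 0"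
proof -
  assume "\<not> (c \<le> p \<and> c + s \<le> p + q \<and> (c < p \<longrightarrow> c + s < p + q))"
  then have "{xs. stopped ((p, q), nz [l]) (c, s) xs} = {}" using stopped_bounds by blast
  then show ?thesis by (simp add: Kz_def)
qed

section \<open>Unranking\<close>

text \<open>Only the head of the stack takes part in a transition.\<close>

lemma step_append:
  assumes "0 \<notin> set M" "L \<noteq> []"
  shows "step (pq, L @ M) x = (fst (step (pq, L) x), snd (step (pq, L) x) @ M)"
  using assms by (cases L) (auto simp: nz_def filter_id_conv split: prod.split intro: gr0I)

lemma room_append: "L \<noteq> [] \<Longrightarrow> room (pq, L @ M) = room (pq, L)"
  by (cases pq; cases L) auto

lemma stopped_Cons_append:
  assumes "snd S \<noteq> []"
  shows "(\<exists>u v. x # xs = u @ v \<and> stopped S cs u \<and> P v) \<longleftrightarrow>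
    x < room S \<and> (\<exists>u v. xs = u @ v \<and> stopped (step S x) cs u \<and> P v)" (is "?l \<longleftrightarrow> ?r")
proof
  assume ?l
  then obtain u v where *: "x # xs = u @ v" "stopped S cs u" "P v" by blast
  then obtain u' where u: "u = x # u'" using assms by (cases u) auto
  then have "xs = u' @ v" using * by simp
  then show ?r using * u by auto
next
  assume ?r
  then obtain u v where "x < room S" "xs = u @ v" "stopped (step S x) cs u" "P v" by blast
  then have "x # xs = (x # u) @ v" "stopped S cs (x # u)" using assms by simp_all
  then show ?l using \<open>P v\<close> by blast
qed

text \<open>A run on a stack \<open>L @ M\<close> is cut at the first moment when \<open>L\<close> is used up. The predicate \<open>D\<close> stands for
  \<open>complete\<close> and for \<open>stopped\<close>.\<close>

lemma run_append:
  assumes "0 \<notin> set L" "0 \<notin> set M"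
    and Nil: "\<And>pq L. L \<noteq> [] \<Longrightarrow> 0 \<notin> set L \<Longrightarrow> \<not> D (pq, L @ M) []"
    and Cons: "\<And>pq L x xs. L \<noteq> [] \<Longrightarrow>
      D (pq, L @ M) (x # xs) \<longleftrightarrow> x < room (pq, L @ M) \<and> D (step (pq, L @ M) x) xs"
  shows "D (pq, L @ M) xs \<longleftrightarrow> (\<exists>u v ct. xs = u @ v \<and> stopped (pq, L) ct u \<and> D (ct, M) v)"
  using assms(1)
proof (induction xs arbitrary: pq L)
  case Nil
  then show ?case using assms(3) by (cases "L = []") (auto simp: stopped_Nil)
next
  case (Cons x xs)
  show ?case
  proof (cases "L = []")
    case False
    obtain pq' L' where s: "step (pq, L) x = (pq', L')" by (metis surj_pair)
    have "0 \<notin> set L'" using zero_free_step[of "(pq, L)" x] s by simp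
    note IH = Cons.IH[OF this]
    have "(\<exists>u v ct. x # xs = u @ v \<and> stopped (pq, L) ct u \<and> D (ct, M) v) \<longleftrightarrow>
      (\<exists>ct. \<exists>u v. x # xs = u @ v \<and> stopped (pq, L) ct u \<and> D (ct, M) v)"
      by blast
    also have "\<dots> \<longleftrightarrow> x < room (pq, L) \<and>
      (\<exists>ct. \<exists>u v. xs = u @ v \<and> stopped (step (pq, L) x) ct u \<and> D (ct, M) v)"
      using False by (simp only: stopped_Cons_append snd_conv not_False_eq_True) blast
    finally show ?thesis
      using False s IH
      by (simp add: assms(4) room_append step_append[OF assms(2)] del: step.simps room.simps) blast
  qed (simp add: stopped_Nil)
qed

lemma complete_append:
  assumes "0 \<notin> set L" "0 \<notin> set M"
  shows "complete (pq, L @ M) xs \<longleftrightarrow> (\<exists>u v ct. xs = u @ v \<and> stopped (pq, L) ct u \<and> complete (ct, M) v)"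
proof (rule run_append[OF assms])
  show "\<not> complete (pq, L @ M) []" if "L \<noteq> []" "0 \<notin> set L" for pq L
    using that by (cases pq; cases L) auto
qed simp

lemma stopped_append:
  assumes "0 \<notin> set L" "0 \<notin> set M"
  shows "stopped (pq, L @ M) cs xs \<longleftrightarrow> (\<exists>u v ct. xs = u @ v \<and> stopped (pq, L) ct u \<and> stopped (ct, M) cs v)"
  by (rule run_append[OF assms]) auto

text \<open>No stopped path is a proper prefix of another one from the same state. This makes
  all decompositions into stopped paths unique.\<close>

lemma stopped_prefix_unique:
  "stopped S cs u \<Longrightarrow> stopped S cs' u' \<Longrightarrow> u @ v = u' @ v' \<Longrightarrow> u = u' \<and> cs = cs'"
proof (induction u arbitrary: S u')
  case Nil
  then show ?case by (cases u') auto
next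
  case (Cons x u)
  from Cons.prems obtain w where w: "u' = x # w" by (cases u') auto
  have "u = w \<and> cs = cs'" by (rule Cons.IH[of "step S x"]) (use Cons.prems w in simp_all)
  then show ?case using w by simp
qed

type_synonym frame = "nat \<times> control"
type_synonym config = "control \<times> frame list"

text \<open>A frame is a stack entry, possibly zero, with the control at which it has to be used up. After the last
  frame the run ends at \<open>((0, 0), [])\<close>.\<close>

fun codes :: "config \<Rightarrow> nat list set" where
  "codes (pq, []) = {xs. complete (pq, []) xs}"
| "codes (pq, (l, cs) # F) = {u @ v |u v. stopped (pq, nz [l]) cs u \<and> v \<in> codes (cs, F)}"

fun weight :: "config \<Rightarrow> nat" where
  "weight (pq, []) = G pq"
| "weight (pq, (l, cs) # F) = Kz l pq cs * weight (cs, F)"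

lemma card_codes: "card (codes C) = weight C"
proof (induction C rule: codes.induct)
  case (2 pq l cs F)
  let ?U = "{u. stopped (pq, nz [l]) cs u}"
  have "codes (pq, (l, cs) # F) = (\<lambda>(u, v). u @ v) ` (?U \<times> codes (cs, F))"
    by auto
  moreover have "inj_on (\<lambda>(u, v). u @ v) (?U \<times> codes (cs, F))"
    by (auto intro!: inj_onI dest: stopped_prefix_unique)
  ultimately have "card (codes (pq, (l, cs) # F)) = card (?U \<times> codes (cs, F))"
    by (simp add: card_image)
  then show ?case using 2 by (simp add: card_cartesian_product Kz_def)
qed (simp add: G_eq_card)

fun top_len :: "frame list \<Rightarrow> nat" where
  "top_len [] = 0"
| "top_len ((l, cs) # F) = l"

fun set_top :: "nat \<Rightarrow> frame list \<Rightarrow> frame list" where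
  "set_top j [] = []"
| "set_top j ((l, cs) # F) = (j, cs) # F"

definition width :: "config \<Rightarrow> nat" where
  "width C = fst (fst C) + snd (fst C) + top_len (snd C)"

text \<open>The configuration after the move with index \<open>x\<close>, if the first of the two pieces of the top frame is to be
  used up at control \<open>ct\<close>; the second one inherits the old target. At an empty stack there is no top frame,
  and then the second piece is 0.\<close>

fun extend :: "config \<Rightarrow> nat \<times> control \<Rightarrow> config" where
  "extend (pq, F) (x, ct) = (case branch pq (top_len F) x of (pq', i, j) \<Rightarrow> (pq', (i, ct) # set_top j F))"

lemma branch_zero: "x < p + q \<Longrightarrow> branch (p, q) l x = (pq', i, j) \<Longrightarrow> j = 0"
  by (auto split: if_splits)

text \<open>The move with index \<open>x\<close> leaves a stack \<open>nz [i] @ nz [j]\<close>, and the rest of the path is cut where the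
  first part is used up. The control at that moment is \<open>ct\<close>.\<close>

lemma codes_extend:
  assumes "snd C \<noteq> [] \<Longrightarrow> top_len (snd C) \<noteq> 0"
  shows "x # xs \<in> codes C \<longleftrightarrow> x < width C \<and> (\<exists>ct. xs \<in> codes (extend C (x, ct)))"
proof -
  obtain p q F where C: "C = ((p, q), F)" by (metis surj_pair)
  obtain pq' i j where b: "branch (p, q) (top_len F) x = (pq', i, j)" by (metis surj_pair)
  show ?thesis
  proof (cases F)
    case Nil
    have "x # xs \<in> codes C \<longleftrightarrow> x < p + q \<and> complete (pq', nz [i]) xs"
      using b branch_zero[of x p q 0 pq' i j] C Nil by (auto simp: nz_second_zero)
    also have "\<dots> \<longleftrightarrow> x < p + q \<and> (\<exists>ct. xs \<in> codes (pq', [(i, ct)]))"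
      using complete_append[of "nz [i]" "[]" pq' xs] by auto
    finally show ?thesis using C Nil b by (simp add: width_def)
  next
    case (Cons f F')
    obtain l cs where f: "f = (l, cs)" by (cases f)
    have l: "l \<noteq> 0" using assms C Cons f by auto
    have "x # xs \<in> codes C \<longleftrightarrow>
        (\<exists>u v. x # xs = u @ v \<and> stopped ((p, q), [l]) cs u \<and> v \<in> codes (cs, F'))"
      using C Cons f l by simp
    also have "\<dots> \<longleftrightarrow> x < p + q + l \<and>
        (\<exists>u v. xs = u @ v \<and> stopped (pq', nz [i] @ nz [j]) cs u \<and> v \<in> codes (cs, F'))"
      using b Cons f nz_simps(4)[of "[i]" "[j]"] by (subst stopped_Cons_append) simp_all
    also have "\<dots> \<longleftrightarrow> x < p + q + l \<and>
        (\<exists>u1 u2 v ct. xs = u1 @ u2 @ v \<and> stopped (pq', nz [i]) ct u1 \<and> stopped (ct, nz [j]) cs u2 \<and> v \<in> codes (cs, F'))"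
      unfolding stopped_append[OF nz_simps(6) nz_simps(6)] by (metis append.assoc)
    also have "\<dots> \<longleftrightarrow> x < p + q + l \<and> (\<exists>ct. xs \<in> codes (pq', (i, ct) # (j, cs) # F'))"
      by (simp, metis append.assoc)
    finally show ?thesis using C Cons f b by (simp add: width_def)
  qed
qed

text \<open>The number of values that remain to be written.\<close>

definition mass :: "config \<Rightarrow> nat" where
  "mass C = fst (fst C) + snd (fst C) + sum_list (map fst (snd C))"

lemma mass_extend: "x < width C \<Longrightarrow> Suc (mass (extend C (x, ct))) = mass C"
proof -
  obtain p q F where C: "C = ((p, q), F)" by (metis surj_pair)
  assume "x < width C"
  then show ?thesis using C by (cases F) (auto simp: width_def mass_def)
qed

text \<open>Bounds the number of iterations that the program still makes: each move lowers the mass by one and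
  pushes one frame, which may have to be removed later.\<close>

definition fuel :: "config \<Rightarrow> nat" where
  "fuel C = 2 * mass C + length (snd C)"

lemma length_extend: "length (snd (extend C z)) = Suc (length (snd C))"
proof -
  obtain pq F x ct where "C = (pq, F)" "z = (x, ct)" by (metis surj_pair)
  then show ?thesis by (cases F) (auto split: prod.split)
qed

lemma fuel_extend: "x < width C \<Longrightarrow> Suc (fuel (extend C (x, ct))) = fuel C"
  using mass_extend[of x C ct] length_extend[of C "(x, ct)"] by (simp add: fuel_def)

text \<open>The coordinates of a target that can be reached are at most the number of remaining values, so every bound
  \<open>n\<close> on the mass serves. It stays the same during the run.\<close>

definition candidates :: "nat \<Rightarrow> config \<Rightarrow> (nat \<times> control) list" where
  "candidates n C = List.product [0..<width C] (List.product [0..<Suc n] [0..<Suc n])"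

text \<open>Position of a number in a sum of weights: the summand that it falls into and the offset there.\<close>

fun locate :: "('a \<Rightarrow> nat) \<Rightarrow> 'a list \<Rightarrow> nat \<Rightarrow> 'a \<times> nat" where
  "locate w [] y = undefined"
| "locate w (z # zs) y = (if y < w z then (z, y) else locate w zs (y - w z))"

lemma bij_betw_locate:
  "distinct zs \<Longrightarrow> bij_betw (locate w zs) {..<sum_list (map w zs)} (Sigma (set zs) (\<lambda>z. {..<w z}))"
proof (induction zs)
  case Nil
  then show ?case by (simp add: bij_betw_def)
next
  case (Cons z zs)
  let ?s = "sum_list (map w zs)"
  have IH: "bij_betw (locate w zs) {..<?s} (Sigma (set zs) (\<lambda>z. {..<w z}))" using Cons by simp
  have "bij_betw (locate w (z # zs)) {..<w z} ({z} \<times> {..<w z})"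
    by (auto simp: bij_betw_def inj_on_def)
  moreover have "bij_betw (\<lambda>y. y - w z) {w z..<w z + ?s} {..<?s}"
    by (rule bij_betwI[where g = "\<lambda>y. y + w z"]) auto
  then have "bij_betw (locate w zs \<circ> (\<lambda>y. y - w z)) {w z..<w z + ?s} (Sigma (set zs) (\<lambda>z. {..<w z}))"
    using IH by (rule bij_betw_trans)
  then have "bij_betw (locate w (z # zs)) {w z..<w z + ?s} (Sigma (set zs) (\<lambda>z. {..<w z}))"
    by (rule bij_betw_cong[THEN iffD1, rotated]) auto
  ultimately have "bij_betw (locate w (z # zs)) ({..<w z} \<union> {w z..<w z + ?s})
      ({z} \<times> {..<w z} \<union> Sigma (set zs) (\<lambda>z. {..<w z}))"
    by (rule bij_betw_combine) (use Cons.prems in auto)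
  moreover have "{..<w z} \<union> {w z..<w z + ?s} = {..<sum_list (map w (z # zs))}" by auto
  moreover have "{z} \<times> {..<w z} \<union> Sigma (set zs) (\<lambda>z. {..<w z}) = Sigma (set (z # zs)) (\<lambda>z. {..<w z})" by auto
  ultimately show ?case by (simp only:)
qed

text \<open>The argument \<open>r\<close> bounds the number of iterations (see \<open>fuel\<close>) and makes the recursion primitive. A frame
  of length 0 contributes the factor 1 to the weight if its target is the present control, and 0 otherwise, so
  it can be dropped.\<close>

fun unrank :: "nat \<Rightarrow> nat \<Rightarrow> config \<Rightarrow> nat \<Rightarrow> nat list" where
  "unrank n 0 C y = []"
| "unrank n (Suc r) C y =
    (if snd C \<noteq> [] \<and> top_len (snd C) = 0 then unrank n r (fst C, tl (snd C)) y
     else if width C = 0 then []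
     else case locate (weight \<circ> extend C) (candidates n C) y of
       (z, y') \<Rightarrow> fst z # unrank n r (extend C z) y')"

text \<open>The control at which the pushed frame is used up can be read off the path.\<close>

lemma codes_extend_disjoint:
  assumes "xs \<in> codes (extend C (x, ct))" "xs \<in> codes (extend C (x, ct'))"
  shows "ct = ct'"
proof -
  obtain pq F where C: "C = (pq, F)" by (metis surj_pair)
  obtain pq' i j where b: "branch pq (top_len F) x = (pq', i, j)" by (metis surj_pair)
  show ?thesis using assms C b by (auto dest: stopped_prefix_unique)
qed

lemma codes_zero: "codes ((0, 0), []) = {[]}"
  by (auto; case_tac x) auto

lemma weight_zero: "weight ((0, 0), []) = 1"
  using card_codes[of "((0, 0), [])"] unfolding codes_zero by simp

text \<open>The bound \<open>n\<close> on the targets loses nothing: by \<open>stopped_bounds\<close> the sum of the coordinates of a target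
  that is reached is at most the number of remaining values.\<close>

lemma codes_first_index:
  assumes "snd C \<noteq> [] \<Longrightarrow> top_len (snd C) \<noteq> 0" "width C \<noteq> 0" "mass C \<le> n"
  shows "codes C = (\<Union>z\<in>set (candidates n C). (#) (fst z) ` codes (extend C z))"
proof (intro equalityI subsetI)
  obtain p q F where C: "C = ((p, q), F)" by (metis surj_pair)
  fix xs assume xs: "xs \<in> codes C"
  have "[] \<notin> codes C" using assms(1,2) C by (cases F) (auto simp: width_def)
  then obtain x xs' where e: "xs = x # xs'" using xs by (cases xs) auto
  then obtain ct where ct: "x < width C" "xs' \<in> codes (extend C (x, ct))"
    using codes_extend[of C x xs'] assms(1) xs by auto
  obtain pq' i j where b: "branch (p, q) (top_len F) x = (pq', i, j)" by (metis surj_pair)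
  obtain p' q' c s where d: "pq' = (p', q')" "ct = (c, s)" by (metis surj_pair)
  then obtain u where "stopped ((p', q'), nz [i]) (c, s) u" using ct(2) C b by auto
  then have "c + s \<le> p' + q'" using stopped_bounds by blast
  also have "\<dots> \<le> mass (extend C (x, ct))" using C b d by (simp add: mass_def)
  also have "\<dots> \<le> n" using mass_extend[OF ct(1), of ct] assms(3) by simp
  finally have "(x, ct) \<in> set (candidates n C)" using ct(1) d by (auto simp: candidates_def)
  then show "xs \<in> (\<Union>z\<in>set (candidates n C). (#) (fst z) ` codes (extend C z))"
    using e ct(2) by force
next
  fix xs assume "xs \<in> (\<Union>z\<in>set (candidates n C). (#) (fst z) ` codes (extend C z))"
  then obtain z xs' where z: "z \<in> set (candidates n C)" "xs = fst z # xs'" "xs' \<in> codes (extend C z)"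
    by blast
  obtain x ct where "z = (x, ct)" by (rule prod.exhaust)
  then have "x < width C" "xs = x # xs'" "xs' \<in> codes (extend C (x, ct))"
    using z by (auto simp: candidates_def)
  then show "xs \<in> codes C" using codes_extend[of C x xs'] assms(1) by blast
qed

lemma codes_pop: "codes (pq, (0, cs) # F) = (if pq = cs then codes (cs, F) else {})"
  by (auto simp: stopped_Nil)

lemma width_0_cases:
  assumes "snd C \<noteq> [] \<Longrightarrow> top_len (snd C) \<noteq> 0" "width C = 0"
  shows "C = ((0, 0), [])"
  using assms by (cases C; cases "snd C") (auto simp: width_def)

lemma finite_codes: "finite (codes C)"
proof (induction "fuel C" arbitrary: C rule: less_induct)
  case less
  show ?case
  proof (cases "snd C \<noteq> [] \<and> top_len (snd C) = 0")
    case True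
    then obtain pq cs F where C: "C = (pq, (0, cs) # F)" by (cases C; cases "snd C") auto
    have "finite (codes (pq, F))" using C by (intro less) (simp add: fuel_def mass_def)
    then show ?thesis unfolding C codes_pop by auto
  next
    case False
    show ?thesis
    proof (cases "width C = 0")
      case True
      then show ?thesis using width_0_cases[of C] False codes_zero by fastforce
    next
      case width: False
      have "finite (codes (extend C z))" if "z \<in> set (candidates (mass C) C)" for z
      proof -
        obtain x ct where z: "z = (x, ct)" by (rule prod.exhaust)
        then have "x < width C" using that by (auto simp: candidates_def)
        then show ?thesis using fuel_extend[of x C ct] z by (intro less) simp
      qed
      then show ?thesis using False width by (subst codes_first_index[of C "mass C"]) auto
    qed
  qed
qed

lemma distinct_candidates: "distinct (candidates n C)"
  unfolding candidates_def by (intro distinct_product distinct_upt)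

lemma disjoint_first_index:
  assumes "xs \<in> codes (extend C z)" "xs' \<in> codes (extend C z')" "fst z # xs = fst z' # xs'"
  shows "z = z'"
  using assms codes_extend_disjoint[of xs C "fst z" "snd z" "snd z'"] by (cases z; cases z') auto

lemma weight_eq_sum:
  assumes "snd C \<noteq> [] \<Longrightarrow> top_len (snd C) \<noteq> 0" "width C \<noteq> 0" "mass C \<le> n"
  shows "weight C = (\<Sum>z\<leftarrow>candidates n C. weight (extend C z))"
proof -
  have "weight C = card (\<Union>z\<in>set (candidates n C). (#) (fst z) ` codes (extend C z))"
    using card_codes[of C] codes_first_index[OF assms] by simp
  also have "\<dots> = (\<Sum>z\<in>set (candidates n C). card ((#) (fst z) ` codes (extend C z)))"
  proof (rule card_UN_disjoint)
    show "\<forall>z\<in>set (candidates n C). finite ((#) (fst z) ` codes (extend C z))"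
      by (intro ballI finite_imageI finite_codes)
    show "\<forall>z\<in>set (candidates n C). \<forall>z'\<in>set (candidates n C). z \<noteq> z' \<longrightarrow>
        (#) (fst z) ` codes (extend C z) \<inter> (#) (fst z') ` codes (extend C z') = {}"
      using disjoint_first_index by blast
  qed simp
  also have "\<dots> = (\<Sum>z\<in>set (candidates n C). weight (extend C z))"
    by (simp add: card_image inj_on_def card_codes)
  also have "\<dots> = (\<Sum>z\<leftarrow>candidates n C. weight (extend C z))"
    by (rule sum_list_distinct_conv_sum_set[OF distinct_candidates, symmetric])
  finally show ?thesis .
qed

lemma bij_betw_locate_candidates:
  assumes "snd C \<noteq> [] \<Longrightarrow> top_len (snd C) \<noteq> 0" "width C \<noteq> 0" "mass C \<le> n"
  shows "bij_betw (locate (weight \<circ> extend C) (candidates n C)) {..<weight C}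
    (Sigma (set (candidates n C)) (\<lambda>z. {..<weight (extend C z)}))"
  using bij_betw_locate[OF distinct_candidates, of "weight \<circ> extend C" n C] weight_eq_sum[OF assms]
  by (simp add: o_def)

text \<open>By induction: \<open>locate\<close> finds the summand of the disjoint union \<open>codes_first_index\<close>, and the offset is the rank
  within it.\<close>

lemma bij_betw_unrank:
  "fuel C \<le> r \<Longrightarrow> mass C \<le> n \<Longrightarrow> bij_betw (unrank n r C) {..<weight C} (codes C)"
proof (induction r arbitrary: C)
  case 0
  then have "C = ((0, 0), [])" by (cases C) (auto simp: fuel_def mass_def)
  then show ?case
    by (simp add: codes_zero weight_zero bij_betw_def lessThan_Suc del: weight.simps codes.simps)
next
  case (Suc r)
  show ?case
  proof (cases "snd C \<noteq> [] \<and> top_len (snd C) = 0")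
    case True
    then obtain pq cs F where C: "C = (pq, (0, cs) # F)" by (cases C; cases "snd C") auto
    have "unrank n (Suc r) C = unrank n r (pq, F)" using True C by (auto simp: fun_eq_iff)
    moreover have "bij_betw (unrank n r (pq, F)) {..<weight (pq, F)} (codes (pq, F))"
      using Suc.prems C by (intro Suc.IH) (auto simp: fuel_def mass_def)
    ultimately show ?thesis
      by (cases "pq = cs") (simp_all add: C Kz_0 codes_pop bij_betw_def del: codes.simps unrank.simps)
  next
    case top: False
    show ?thesis
    proof (cases "width C = 0")
      case True
      then have "C = ((0, 0), [])" using top width_0_cases[of C] by blast
      then show ?thesis using True
        by (simp add: codes_zero weight_zero bij_betw_def lessThan_Suc del: weight.simps codes.simps)
    next
      case width: False
      let ?zs = "candidates n C"
      let ?g = "\<lambda>(z, y). fst z # unrank n r (extend C z) y"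
      let ?S = "Sigma (set ?zs) (\<lambda>z. {..<weight (extend C z)})"
      have IH: "bij_betw (unrank n r (extend C z)) {..<weight (extend C z)} (codes (extend C z))"
        if "z \<in> set ?zs" for z
      proof -
        obtain x ct where z: "z = (x, ct)" by (rule prod.exhaust)
        then have "x < width C" using that by (auto simp: candidates_def)
        then show ?thesis using fuel_extend[of x C ct] mass_extend[of x C ct] Suc.prems z
          by (intro Suc.IH) auto
      qed
      have "bij_betw ?g ?S (codes C)"
      proof (rule bij_betw_imageI)
        show "inj_on ?g ?S"
        proof (rule inj_onI)
          fix a b assume ab: "a \<in> ?S" "b \<in> ?S" "?g a = ?g b"
          obtain z y z' y' where e: "a = (z, y)" "b = (z', y')" by (metis surj_pair)
          then have m: "z \<in> set ?zs" "y < weight (extend C z)" "z' \<in> set ?zs" "y' < weight (extend C z')"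
            and eq: "fst z # unrank n r (extend C z) y = fst z' # unrank n r (extend C z') y'"
            using ab by simp_all
          have "z = z'"
            using bij_betw_apply[OF IH[OF m(1)], of y] bij_betw_apply[OF IH[OF m(3)], of y'] m eq
            by (intro disjoint_first_index[OF _ _ eq]) simp_all
          moreover from this have "y = y'" using eq m IH[OF m(1)] by (auto simp: bij_betw_def inj_on_def)
          ultimately show "a = b" using e by simp
        qed
        have "?g ` ?S = (\<Union>z\<in>set ?zs. (#) (fst z) ` unrank n r (extend C z) ` {..<weight (extend C z)})"
          by (auto simp: image_iff)
        also have "\<dots> = (\<Union>z\<in>set ?zs. (#) (fst z) ` codes (extend C z))"
          using IH by (simp add: bij_betw_def)
        also have "\<dots> = codes C"
          using top width Suc.prems by (intro codes_first_index[symmetric]) auto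
        finally show "?g ` ?S = codes C" .
      qed
      moreover have "bij_betw (locate (weight \<circ> extend C) ?zs) {..<weight C} ?S"
        using top width Suc.prems by (intro bij_betw_locate_candidates) auto
      ultimately have "bij_betw (?g \<circ> locate (weight \<circ> extend C) ?zs) {..<weight C} (codes C)"
        by (rule bij_betw_trans[rotated])
      moreover have "unrank n (Suc r) C = ?g \<circ> locate (weight \<circ> extend C) ?zs"
        using top width by (intro ext) (simp only: unrank.simps if_False o_apply case_prod_beta)
      ultimately show ?thesis by (simp only:)
    qed
  qed
qed

section \<open>Total correctness and cost of programs\<close>

type_synonym assertion = "memory \<Rightarrow> nat \<Rightarrow> bool"

text \<open>Weakest preconditions for total correctness of deterministic commands. The postcondition also receives
  the cost, relative to the start. For loops the precondition is semantic and established by \<open>wp_While\<close>.\<close>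

primrec wp :: "(entry \<Rightarrow> int option) \<Rightarrow> com \<Rightarrow> assertion \<Rightarrow> memory \<Rightarrow> bool" where
  "wp tab Skip Q m \<longleftrightarrow> Q m 1"
| "wp tab (Store x e f) Q m \<longleftrightarrow>
     Q (store x (eval_exp e m) (eval_exp f m) m) (1 + cost_exp e + cost_exp f)"
| "wp tab (Lookup x e r) Q m \<longleftrightarrow> (case tab (eval_ref r m) of None \<Rightarrow> False
     | Some y \<Rightarrow> Q (store x (eval_exp e m) y m) (1 + cost_exp e + cost_ref r))"
| "wp tab (Draw x e r) Q m \<longleftrightarrow> False"
| "wp tab (Seq c d) Q m \<longleftrightarrow> wp tab c (\<lambda>m' k. wp tab d (\<lambda>m'' k'. Q m'' (k + k')) m') m"
| "wp tab (Cond b c d) Q m \<longleftrightarrow>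
     (if eval_bexp b m then wp tab c (\<lambda>m' k. Q m' (1 + cost_bexp b + k)) m
      else wp tab d (\<lambda>m' k. Q m' (1 + cost_bexp b + k)) m)"
| "wp tab (While b c) Q m \<longleftrightarrow>
     (\<exists>m' k. (\<forall>t. exec tab (While b c) (m, t) = return_spmf (m', t + k)) \<and> Q m' k)"

lemma wp_sound:
  "wp tab c Q m \<Longrightarrow> \<exists>m' k. (\<forall>t. exec tab c (m, t) = return_spmf (m', t + k)) \<and> Q m' k"
proof (induction c arbitrary: Q m)
  case (Seq c d)
  from Seq.IH(1)[OF Seq.prems[unfolded wp.simps]] obtain m1 k1 where
    1: "\<forall>t. exec tab c (m, t) = return_spmf (m1, t + k1)" "wp tab d (\<lambda>m'' k'. Q m'' (k1 + k')) m1" by blast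
  from Seq.IH(2)[OF 1(2)] obtain m2 k2 where
    2: "\<forall>t. exec tab d (m1, t) = return_spmf (m2, t + k2)" "Q m2 (k1 + k2)" by blast
  show ?case using 1(1) 2 by (intro exI[of _ m2] exI[of _ "k1 + k2"]) (simp add: add.assoc)
next
  case (Cond b c d)
  show ?case
  proof (cases "eval_bexp b m")
    case True
    then have "wp tab c (\<lambda>m' k. Q m' (1 + cost_bexp b + k)) m" using Cond.prems by simp
    from Cond.IH(1)[OF this] obtain m' k where
      "\<forall>t. exec tab c (m, t) = return_spmf (m', t + k)" "Q m' (1 + cost_bexp b + k)" by blast
    then show ?thesis using True by (intro exI[of _ m'] exI[of _ "1 + cost_bexp b + k"]) (simp add: ac_simps)
  next
    case False
    then have "wp tab d (\<lambda>m' k. Q m' (1 + cost_bexp b + k)) m" using Cond.prems by simp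
    from Cond.IH(2)[OF this] obtain m' k where
      "\<forall>t. exec tab d (m, t) = return_spmf (m', t + k)" "Q m' (1 + cost_bexp b + k)" by blast
    then show ?thesis using False by (intro exI[of _ m'] exI[of _ "1 + cost_bexp b + k"]) (simp add: ac_simps)
  qed
next
  case (While b c)
  then show ?case by (simp only: wp.simps)
next
  case (Lookup x e r)
  then show ?case by (auto split: option.splits simp: add.assoc)
qed (auto simp: add.assoc)

lemma wp_mono: "wp tab c Q m \<Longrightarrow> (\<And>m' k. Q m' k \<Longrightarrow> Q' m' k) \<Longrightarrow> wp tab c Q' m"
proof (induction c arbitrary: Q Q' m)
  case (Seq c d)
  show ?case unfolding wp.simps
    by (rule Seq.IH(1)[OF Seq.prems(1)[unfolded wp.simps]]) (rule Seq.IH(2), assumption, rule Seq.prems(2))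
next
  case (Cond b c d)
  show ?case using Cond.prems(1) Cond.IH(1)[OF _ Cond.prems(2)] Cond.IH(2)[OF _ Cond.prems(2)]
    unfolding wp.simps by (simp split: if_splits)
next
  case (While b c)
  then show ?case unfolding wp.simps by blast
qed (auto split: option.splits)

text \<open>\<open>r\<close> bounds the number of iterations that remain and \<open>B\<close> the cost of one of them. The final test of the
  guard accounts for the successor in the bound.\<close>

lemma wp_While:
  assumes step: "\<And>r m. I r m \<Longrightarrow> eval_bexp b m \<Longrightarrow> wp tab c (\<lambda>m' k. k \<le> B \<and> (\<exists>r'<r. I r' m')) m"
    and init: "I r m"
    and post: "\<And>r' m' k. I r' m' \<Longrightarrow> \<not> eval_bexp b m' \<Longrightarrow> k \<le> Suc r * (B + 1 + cost_bexp b) \<Longrightarrow> Q m' k"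
  shows "wp tab (While b c) Q m"
proof -
  define g where "g = (\<lambda>(m :: memory, t :: nat). eval_bexp b m)"
  define f where "f = (\<lambda>(m, t). exec tab c (m, t + 1 + cost_bexp b))"
  have "\<exists>m' k. (\<forall>t. while_spmf g f (m, t) = return_spmf (m', t + k)) \<and>
      (\<exists>r'. I r' m') \<and> \<not> eval_bexp b m' \<and> k \<le> r * (B + 1 + cost_bexp b)"
    using init
  proof (induction r arbitrary: m rule: less_induct)
    case (less r)
    show ?case
    proof (cases "eval_bexp b m")
      case True
      obtain m1 k1 r1 where 1: "\<And>t. exec tab c (m, t) = return_spmf (m1, t + k1)" "k1 \<le> B" "r1 < r" "I r1 m1"
        using wp_sound[OF step[OF less.prems True]] by blast
      obtain m' k where 2: "\<And>t. while_spmf g f (m1, t) = return_spmf (m', t + k)"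
        "\<exists>r'. I r' m'" "\<not> eval_bexp b m'" "k \<le> r1 * (B + 1 + cost_bexp b)"
        using less.IH[OF 1(3,4)] by blast
      have "while_spmf g f (m, t) = return_spmf (m', t + (1 + cost_bexp b + k1 + k))" for t
        by (subst while_spmf.simps) (simp add: True 1(1) 2(1) g_def[THEN fun_cong] f_def[THEN fun_cong] ac_simps)
      moreover have "1 + cost_bexp b + k1 + k \<le> Suc r1 * (B + 1 + cost_bexp b)" using 1(2) 2(4) by simp
      moreover have "\<dots> \<le> r * (B + 1 + cost_bexp b)" using 1(3) by (intro mult_right_mono) auto
      ultimately show ?thesis using 2 by (meson order_trans)
    next
      case False
      then have "while_spmf g f (m, t) = return_spmf (m, t + 0)" for t
        by (subst while_spmf.simps) (simp add: g_def[THEN fun_cong])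
      then show ?thesis using False less.prems by blast
    qed
  qed
  then obtain m' k r' where *: "\<And>t. while_spmf g f (m, t) = return_spmf (m', t + k)"
    "I r' m'" "\<not> eval_bexp b m'" "k \<le> r * (B + 1 + cost_bexp b)" by blast
  have "exec tab (While b c) (m, t) = return_spmf (m', t + (k + 1 + cost_bexp b))" for t
    unfolding exec.simps g_def[symmetric] f_def[symmetric] *(1) by (simp add: ac_simps)
  moreover have "k + 1 + cost_bexp b \<le> Suc r * (B + 1 + cost_bexp b)" using *(4) by simp
  ultimately show ?thesis unfolding wp.simps using post[OF *(2,3)] by blast
qed

lemma store_apply [simp]: "store x i v m y j = (if x = y \<and> i = j then v else m y j)"
  by (simp add: store_def)

abbreviation Var :: "string \<Rightarrow> exp" where "Var x \<equiv> Cell x (Num 0)"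

definition For :: "string \<Rightarrow> exp \<Rightarrow> com \<Rightarrow> com" where
  "For v e c = Seq (Store v (Num 0) (Num 0))
     (While (Less (Var v) e) (Seq c (Store v (Num 0) (Plus (Var v) (Num 1)))))"

text \<open>If the body simulates \<open>f k\<close> on an abstract state, then the loop simulates the fold of \<open>f\<close>. The
  constant 14 covers initialisation, guard and increment.\<close>

lemma wp_For:
  fixes M :: nat
  assumes init: "Rel a m"
    and stable: "\<And>a m z. Rel a m \<Longrightarrow> Rel a (store v 0 z m)"
    and bound: "\<And>a m. Rel a m \<Longrightarrow> eval_exp e m = int M"
    and body: "\<And>k a m. k < M \<Longrightarrow> Rel a m \<Longrightarrow> m v 0 = int k \<Longrightarrow>
      wp tab c (\<lambda>m' t. t \<le> B \<and> Rel (f k a) m' \<and> m' v 0 = int k) m"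
    and post: "\<And>m' t. Rel (fold f [0..<M] a) m' \<Longrightarrow> t \<le> Suc M * (B + 14 + cost_exp e) \<Longrightarrow> Q m' t"
  shows "wp tab (For v e c) Q m"
proof -
  define I where "I = (\<lambda>r m. r \<le> M \<and> Rel (fold f [0..<M - r] a) m \<and> m v 0 = int (M - r))"
  have guard: "eval_bexp (Less (Var v) e) m \<longleftrightarrow> 0 < r" if "I r m" for r m
    using that bound by (auto simp: I_def)
  have "wp tab (While (Less (Var v) e) (Seq c (Store v (Num 0) (Plus (Var v) (Num 1)))))
    (\<lambda>m' k'. Q m' (1 + cost_exp (Num 0) + cost_exp (Num 0) + k')) (store v 0 0 m)"
  proof (rule wp_While[where I = I and r = M and B = "B + 6"])
    fix r m assume I: "I r m" and g: "eval_bexp (Less (Var v) e) m"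
    then obtain r' where r: "r = Suc r'" using guard by (cases r) auto
    then have k: "M - r < M" "M - r' = Suc (M - r)" using I by (auto simp: I_def)
    have "wp tab c (\<lambda>m' t. t \<le> B \<and> Rel (f (M - r) (fold f [0..<M - r] a)) m' \<and> m' v 0 = int (M - r)) m"
      using I k by (intro body) (auto simp: I_def)
    then show "wp tab (Seq c (Store v (Num 0) (Plus (Var v) (Num 1)))) (\<lambda>m' k. k \<le> B + 6 \<and> (\<exists>r'<r. I r' m')) m"
      unfolding wp.simps
    proof (rule wp_mono)
      fix m' t assume *: "t \<le> B \<and> Rel (f (M - r) (fold f [0..<M - r] a)) m' \<and> m' v 0 = int (M - r)"
      then have "I r' (store v 0 (m' v 0 + 1) m')"
        using r k I stable unfolding I_def by auto
      then show "t + (1 + cost_exp (Num 0) + cost_exp (Plus (Var v) (Num 1))) \<le> B + 6 \<and>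
          (\<exists>r'<r. I r' (store v (eval_exp (Num 0) m') (eval_exp (Plus (Var v) (Num 1)) m') m'))"
        using * r by auto
    qed
  next
    show "I M (store v 0 0 m)" using init stable by (simp add: I_def)
  next
    fix r' m' k
    assume I: "I r' m'" and "\<not> eval_bexp (Less (Var v) e) m'"
      and k: "k \<le> Suc M * (B + 6 + 1 + cost_bexp (Less (Var v) e))"
    then have "r' = 0" using guard by simp
    then have "Rel (fold f [0..<M] a) m'" using I by (simp add: I_def)
    moreover have "1 + cost_exp (Num 0) + cost_exp (Num 0) + k \<le> Suc M * (B + 14 + cost_exp e)" using k by (simp add: algebra_simps)
    ultimately show "Q m' (1 + cost_exp (Num 0) + cost_exp (Num 0) + k)" by (rule post)
  qed
  then show ?thesis unfolding For_def wp.simps(2,5) eval_exp.simps .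
qed

section \<open>The weight of a candidate\<close>

abbreviation Then :: "com \<Rightarrow> com \<Rightarrow> com" (infixr ";;" 60) where "c ;; d \<equiv> Seq c d"
abbreviation Assign :: "string \<Rightarrow> exp \<Rightarrow> com" (infix "::=" 65) where "x ::= e \<equiv> Store x (Num 0) e"
abbreviation Le :: "exp \<Rightarrow> exp \<Rightarrow> bexp" where "Le e f \<equiv> BNot (Less f e)"
abbreviation Top :: "string \<Rightarrow> exp" where "Top x \<equiv> Cell x (Var ''d'')"

text \<open>Stores the number of stopped paths from \<open>(p, q)\<close> to \<open>(c, s)\<close> in \<open>z\<close>. A lookup outside the table would abort
  the run. If \<open>l + p + q\<close> is at most the size of the table, the guards prevent this, and the values that they
  exclude are 0 by \<open>Kz_eq_0\<close>.\<close>

definition lookup_K :: "string \<Rightarrow> exp \<Rightarrow> exp \<Rightarrow> exp \<Rightarrow> exp \<Rightarrow> exp \<Rightarrow> com" where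
  "lookup_K z l p q c s =
    Cond (Less l (Num 1))
      (Cond (BAnd (BAnd (Le p c) (Le c p)) (BAnd (Le q s) (Le s q))) (z ::= Num 1) (z ::= Num 0))
      (Cond (BAnd (Le c p) (BNot (BAnd (Less q s) (Le (Plus (Minus p c) q) s))))
        (Lookup z (Num 0) (R_ref l (Minus p c) q s))
        (z ::= Num 0))"

lemma wp_lookup_K:
  assumes v: "eval_exp l m = int l'" "eval_exp p m = int p'" "eval_exp q m = int q'"
    "eval_exp c m = int c'" "eval_exp s m = int s'"
    and N: "l' + p' + q' \<le> N"
    and Q: "\<And>k. k \<le> 60 + 5 * (cost_exp l + cost_exp p + cost_exp q + cost_exp c + cost_exp s) \<Longrightarrow>
      Q (store z 0 (int (Kz l' (p', q') (c', s'))) m) k"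
  shows "wp (table N) (lookup_K z l p q c s) Q m"
proof (cases "l' = 0")
  case True
  then show ?thesis using v Q by (auto simp: lookup_K_def Kz_0)
next
  case False
  show ?thesis
  proof (cases "c' \<le> p' \<and> (s' \<le> q' \<or> s' < p' - c' + q')")
    case True
    then have "table N (R_entry (int l') (int p' - int c') (int q') (int s')) = Some (int (Kz l' (p', q') (c', s')))"
      using N False by (auto simp: Kz_eq_R nat_diff_distrib)
    then show ?thesis using v Q True False by (auto simp: lookup_K_def)
  next
    case g: False
    then have "Kz l' (p', q') (c', s') = 0" by (intro Kz_eq_0) auto
    then show ?thesis using v Q g False by (auto simp: lookup_K_def)
  qed
qed

text \<open>The frames are stored from index 1 upwards, the top one at index \<open>d\<close>. The product of the weights below a
  frame is stored with it.\<close>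

fun frames_in :: "frame list \<Rightarrow> memory \<Rightarrow> bool" where
  "frames_in [] m \<longleftrightarrow> True"
| "frames_in ((l, (c, s)) # F) m \<longleftrightarrow>
     m ''len'' (int (Suc (length F))) = int l \<and>
     m ''tc'' (int (Suc (length F))) = int c \<and> m ''ts'' (int (Suc (length F))) = int s \<and>
     m ''below'' (int (Suc (length F))) = int (weight ((c, s), F)) \<and> frames_in F m"

text \<open>The cell 0 of \<open>len\<close> serves as the length of the top of an empty stack.\<close>

fun config_in :: "nat \<Rightarrow> config \<Rightarrow> memory \<Rightarrow> bool" where
  "config_in N ((p, q), F) m \<longleftrightarrow> m ''N'' 0 = int N \<and> m ''p'' 0 = int p \<and> m ''q'' 0 = int q \<and>
     m ''d'' 0 = int (length F) \<and> m ''len'' 0 = 0 \<and> frames_in F m"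

definition agree :: "string set \<Rightarrow> memory \<Rightarrow> memory \<Rightarrow> bool" where
  "agree Z m m' \<longleftrightarrow> (\<forall>z. z \<notin> Z \<longrightarrow> m' z = m z)"

lemma frames_in_cong:
  assumes "\<forall>z\<in>{''len'', ''tc'', ''ts'', ''below''}. \<forall>k\<le>length F. m' z (int k) = m z (int k)"
  shows "frames_in F m' \<longleftrightarrow> frames_in F m"
  using assms by (induction F m rule: frames_in.induct) (auto simp del: of_nat_Suc)

lemma config_in_cong:
  assumes "\<forall>z\<in>{''N'', ''p'', ''q'', ''d'', ''len'', ''tc'', ''ts'', ''below''}. m' z = m z"
  shows "config_in N C m' \<longleftrightarrow> config_in N C m"
proof -
  obtain p q F where "C = ((p, q), F)" by (metis surj_pair)
  then show ?thesis using assms frames_in_cong[of F m' m] by auto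
qed

lemma top_len_in: "config_in N (pq, F) m \<Longrightarrow> m ''len'' (m ''d'' 0) = int (top_len F)"
  by (cases pq; cases F rule: top_len.cases) auto

definition branch_com :: com where
  "branch_com =
    Cond (Less (Var ''x'') (Var ''p''))
      (''p1'' ::= Var ''x'' ;;
       ''q1'' ::= Minus (Minus (Plus (Var ''q'') (Var ''p'')) (Num 1)) (Var ''x'') ;;
       ''i'' ::= Top ''len'' ;; ''j'' ::= Num 0)
      (Cond (Less (Var ''x'') (Plus (Var ''p'') (Var ''q'')))
        (''p1'' ::= Var ''p'' ;; ''q1'' ::= Minus (Var ''x'') (Var ''p'') ;;
         ''i'' ::= Minus (Minus (Plus (Top ''len'') (Var ''q'')) (Num 1)) (Var ''q1'') ;; ''j'' ::= Num 0)
        (''p1'' ::= Var ''p'' ;; ''q1'' ::= Var ''q'' ;;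
         ''i'' ::= Minus (Minus (Var ''x'') (Var ''p'')) (Var ''q'') ;;
         ''j'' ::= Minus (Minus (Top ''len'') (Num 1)) (Var ''i'')))"

lemma wp_branch_com:
  assumes C: "config_in N ((p, q), F) m" and x: "m ''x'' 0 = int x" "x < width ((p, q), F)"
    and b: "branch (p, q) (top_len F) x = ((p', q'), i, j)"
    and Q: "\<And>m' k. agree {''p1'', ''q1'', ''i'', ''j''} m m' \<Longrightarrow> m' ''p1'' 0 = int p' \<Longrightarrow> m' ''q1'' 0 = int q' \<Longrightarrow>
      m' ''i'' 0 = int i \<Longrightarrow> m' ''j'' 0 = int j \<Longrightarrow> k \<le> 60 \<Longrightarrow> Q m' k"
  shows "wp tab branch_com Q m"
proof -
  have v: "m ''p'' 0 = int p" "m ''q'' 0 = int q" "m ''len'' (m ''d'' 0) = int (top_len F)"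
    using C top_len_in[OF C] by auto
  consider "x < p" | "\<not> x < p" "x < p + q" | "\<not> x < p + q" by linarith
  then show ?thesis
  proof cases
    case 1
    then show ?thesis using v x b unfolding branch_com_def
      by (auto simp: agree_def store_def intro!: Q)
  next
    case 2
    then show ?thesis using v x b unfolding branch_com_def
      by (auto simp: agree_def store_def intro!: Q)
  next
    case 3
    then show ?thesis using v x b unfolding branch_com_def
      by (auto simp: agree_def store_def width_def intro!: Q)
  qed
qed

text \<open>Leaves in \<open>a\<close> and \<open>b\<close> two numbers with product the weight of the candidate \<open>(x, (c, s))\<close>. The factor
  \<open>b\<close>, the weight of what lies below the frame to be pushed, is computed only if the first
  one does not vanish; then \<open>c + s\<close> is small enough for the lookups.\<close>

definition weigh :: com where
  "weigh = branch_com ;;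
    lookup_K ''a'' (Var ''i'') (Var ''p1'') (Var ''q1'') (Var ''c'') (Var ''s'') ;;
    Cond (Less (Var ''a'') (Num 1)) Skip
      (Cond (Less (Var ''d'') (Num 1))
        (Lookup ''b'' (Num 0) (G_ref (Var ''c'') (Var ''s'')))
        (lookup_K ''b'' (Var ''j'') (Var ''c'') (Var ''s'') (Top ''tc'') (Top ''ts'') ;;
         ''b'' ::= Times (Var ''b'') (Top ''below'')))"

lemma wp_weigh:
  assumes C: "config_in N C m" and mass: "mass C \<le> N"
    and x: "m ''x'' 0 = int x" "x < width C" and ct: "m ''c'' 0 = int c" "m ''s'' 0 = int s"
    and b: "branch (fst C) (top_len (snd C)) x = ((p', q'), i, j)"
    and Q: "\<And>m' k. agree {''p1'', ''q1'', ''i'', ''j'', ''a'', ''b''} m m' \<Longrightarrow>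
      m' ''p1'' 0 = int p' \<Longrightarrow> m' ''q1'' 0 = int q' \<Longrightarrow> m' ''i'' 0 = int i \<Longrightarrow> m' ''j'' 0 = int j \<Longrightarrow>
      m' ''a'' 0 * m' ''b'' 0 = int (weight (extend C (x, (c, s)))) \<Longrightarrow>
      (0 < weight (extend C (x, (c, s))) \<longrightarrow> m' ''b'' 0 = int (weight ((c, s), set_top j (snd C)))) \<Longrightarrow>
      k \<le> 400 \<Longrightarrow> Q m' k"
  shows "wp (table N) weigh Q m"
proof -
  obtain p q F where Ceq: "C = ((p, q), F)" by (metis surj_pair)
  have b': "branch (p, q) (top_len F) x = ((p', q'), i, j)" using b Ceq by simp
  have E: "extend C (x, (c, s)) = ((p', q'), (i, (c, s)) # set_top j F)" using b' Ceq by simp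
  have me: "p' + q' + i + sum_list (map fst (set_top j F)) < N"
    using mass_extend[OF x(2), of "(c, s)"] mass unfolding E by (simp add: mass_def)
  let ?K = "Kz i (p', q') (c, s)"
  show ?thesis
    unfolding weigh_def wp.simps(5)
  proof (rule wp_branch_com[OF C[unfolded Ceq] x(1) x(2)[unfolded Ceq] b'])
    fix m1 and k1 :: nat assume 1: "agree {''p1'', ''q1'', ''i'', ''j''} m m1" "m1 ''p1'' 0 = int p'" "m1 ''q1'' 0 = int q'"
      "m1 ''i'' 0 = int i" "m1 ''j'' 0 = int j" "k1 \<le> 60"
    have m1: "m1 ''c'' 0 = int c" "m1 ''s'' 0 = int s" "m1 ''d'' 0 = int (length F)"
      using ct C Ceq 1(1) by (auto simp: agree_def)
    have "frames_in F m1" using C Ceq 1(1) frames_in_cong[of F m1 m] by (auto simp: agree_def)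
    let ?m2 = "store ''a'' 0 (int ?K) m1"
    have ag2: "agree {''p1'', ''q1'', ''i'', ''j'', ''a'', ''b''} m (store ''b'' 0 v ?m2)" for v
      using 1(1) by (auto simp: agree_def store_def)
    have ag1: "agree {''p1'', ''q1'', ''i'', ''j'', ''a'', ''b''} m ?m2"
      using 1(1) by (auto simp: agree_def store_def)
    have E0: "weight (extend C (x, (c, s))) = ?K * weight ((c, s), set_top j F)" using E by simp
    show "wp (table N) (lookup_K ''a'' (Var ''i'') (Var ''p1'') (Var ''q1'') (Var ''c'') (Var ''s''))
        (\<lambda>m' k. wp (table N) (Cond (Less (Var ''a'') (Num 1)) Skip
      (Cond (Less (Var ''d'') (Num 1))
        (Lookup ''b'' (Num 0) (G_ref (Var ''c'') (Var ''s'')))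
        (lookup_K ''b'' (Var ''j'') (Var ''c'') (Var ''s'') (Top ''tc'') (Top ''ts'') ;;
         ''b'' ::= Times (Var ''b'') (Top ''below'')))) (\<lambda>m'' k'. Q m'' (k1 + (k + k'))) m') m1"
    proof (rule wp_lookup_K[where l' = i and p' = p' and q' = q' and c' = c and s' = s])
      fix k2 :: nat assume "k2 \<le> 60 + 5 * (cost_exp (Var ''i'') + cost_exp (Var ''p1'') + cost_exp (Var ''q1'') + cost_exp (Var ''c'') + cost_exp (Var ''s''))"
      then have k2: "k2 \<le> 110" by simp
      show "wp (table N) (Cond (Less (Var ''a'') (Num 1)) Skip
      (Cond (Less (Var ''d'') (Num 1))
        (Lookup ''b'' (Num 0) (G_ref (Var ''c'') (Var ''s'')))
        (lookup_K ''b'' (Var ''j'') (Var ''c'') (Var ''s'') (Top ''tc'') (Top ''ts'') ;;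
         ''b'' ::= Times (Var ''b'') (Top ''below'')))) (\<lambda>m'' k'. Q m'' (k1 + (k2 + k'))) ?m2"
      proof (cases "?K = 0")
        case True
        have "Q ?m2 k" if "k \<le> 400" for k
          by (rule Q[OF ag1]) (use True 1 E0 that in simp_all)
        then show ?thesis using True 1(6) k2 by simp
      next
        case False
        then have cs: "c + s \<le> p' + q'" using Kz_eq_0[of c p' s q' i] by linarith
        show ?thesis
        proof (cases F)
          case Nil
          have "Q (store ''b'' 0 (int (G (c, s))) ?m2) k" if "k \<le> 400" for k
            by (rule Q[OF ag2]) (use Nil 1 E0 that Ceq in simp_all)
          moreover have "table N (G_entry (int c) (int s)) = Some (int (G (c, s)))" using cs me by simp
          ultimately show ?thesis using Nil False 1(6) k2 m1 by simp
        next
          case (Cons f F')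
          obtain l c0 s0 where f: "f = (l, (c0, s0))" by (metis surj_pair)
          then have top: "m1 ''tc'' (int (length F)) = int c0" "m1 ''ts'' (int (length F)) = int s0"
            "m1 ''below'' (int (length F)) = int (weight ((c0, s0), F'))"
            using \<open>frames_in F m1\<close> Cons by auto
          have Q': "Q (store ''b'' 0 v ?m2) k" if "k \<le> 400" "v = int (weight ((c, s), set_top j F))" for v k
            by (rule Q[OF ag2]) (use 1 E0 that Ceq in simp_all)
          have "wp (table N) (lookup_K ''b'' (Var ''j'') (Var ''c'') (Var ''s'') (Top ''tc'') (Top ''ts'') ;;
             ''b'' ::= Times (Var ''b'') (Top ''below'')) (\<lambda>m'' k'. k' \<le> 140 \<and>
               (\<exists>v. m'' = store ''b'' 0 v ?m2 \<and> v = int (weight ((c, s), set_top j F)))) ?m2"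
            unfolding wp.simps(5)
            by (rule wp_lookup_K[where l' = j and p' = c and q' = s and c' = c0 and s' = s0])
              (use 1 m1 top me cs Cons f in \<open>simp_all add: store_def\<close>)
          then have "wp (table N) (lookup_K ''b'' (Var ''j'') (Var ''c'') (Var ''s'') (Top ''tc'') (Top ''ts'') ;;
             ''b'' ::= Times (Var ''b'') (Top ''below'')) (\<lambda>m'' k'. k' \<le> 140 \<and> (\<forall>k''\<le>400. Q m'' k'')) ?m2"
            by (rule wp_mono) (use Q' in auto)
          then show ?thesis using False m1 Cons
            by (simp del: wp.simps(5)) (erule wp_mono, use 1(6) k2 in simp)
        qed
      qed
    qed (use 1 m1 me in auto)
  qed
qed

section \<open>Searching and making a move\<close>

text \<open>One step of the search for the summand that contains a rank. After a success the remaining steps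
  do nothing, so the loops need no early exit.\<close>

fun try_candidate :: "('a \<Rightarrow> nat) \<Rightarrow> 'a \<Rightarrow> nat \<times> 'a option \<Rightarrow> nat \<times> 'a option" where
  "try_candidate w z (y, None) = (if y < w z then (y, Some z) else (y - w z, None))"
| "try_candidate w z (y, Some z') = (y, Some z')"

text \<open>The loops of the program compute \<open>locate\<close>.\<close>

lemma fold_try_candidate:
  "y < sum_list (map w zs) \<Longrightarrow>
    fold (try_candidate w) zs (y, None) = (snd (locate w zs y), Some (fst (locate w zs y)))"
proof (induction zs arbitrary: y)
  case (Cons z zs)
  have "fold (try_candidate w) zs (y, Some z) = (y, Some z)" for zs by (induction zs) auto
  then show ?case using Cons by auto
qed simp

lemma fold_product:
  "fold f (List.product xs ys) = fold (\<lambda>x. fold (\<lambda>y. f (x, y)) ys) xs"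
  by (induction xs) (simp_all add: fold_map o_def)

fun found_in :: "nat \<times> (nat \<times> control) option \<Rightarrow> memory \<Rightarrow> bool" where
  "found_in (y, None) m \<longleftrightarrow> m ''y'' 0 = int y \<and> m ''found'' 0 = 0"
| "found_in (y, Some (x, (c, s))) m \<longleftrightarrow> m ''y'' 0 = int y \<and> m ''found'' 0 = 1 \<and>
     m ''fx'' 0 = int x \<and> m ''fc'' 0 = int c \<and> m ''fs'' 0 = int s"

definition probe :: com where
  "probe = weigh ;;
    Cond (Less (Var ''found'') (Num 1))
      (Cond (Less (Var ''y'') (Times (Var ''a'') (Var ''b'')))
        (''found'' ::= Num 1 ;; ''fx'' ::= Var ''x'' ;; ''fc'' ::= Var ''c'' ;; ''fs'' ::= Var ''s'')
        (''y'' ::= Minus (Var ''y'') (Times (Var ''a'') (Var ''b''))))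
      Skip"

definition probe_cells :: "string set" where
  "probe_cells = {''p1'', ''q1'', ''i'', ''j'', ''a'', ''b'', ''found'', ''fx'', ''fc'', ''fs'', ''y''}"

lemma wp_probe:
  assumes C: "config_in N C m" and mass: "mass C \<le> N"
    and x: "m ''x'' 0 = int x" "x < width C" and ct: "m ''c'' 0 = int c" "m ''s'' 0 = int s"
    and st: "found_in st m"
  shows "wp (table N) probe (\<lambda>m' k. k \<le> 500 \<and> agree probe_cells m m' \<and>
    found_in (try_candidate (weight \<circ> extend C) (x, (c, s)) st) m') m"
proof -
  obtain p' q' i j where b: "branch (fst C) (top_len (snd C)) x = ((p', q'), i, j)" by (metis surj_pair)
  show ?thesis unfolding probe_def wp.simps(5)
  proof (rule wp_weigh[OF C mass x ct b])
    fix m1 and k1 :: nat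
    assume ag: "agree {''p1'', ''q1'', ''i'', ''j'', ''a'', ''b''} m m1"
      and w: "m1 ''a'' 0 * m1 ''b'' 0 = int (weight (extend C (x, (c, s))))" and k: "k1 \<le> 400"
    have v: "m1 ''found'' = m ''found''" "m1 ''y'' = m ''y''" "m1 ''fx'' = m ''fx''" "m1 ''fc'' = m ''fc''"
      "m1 ''fs'' = m ''fs''" "m1 ''x'' = m ''x''" "m1 ''c'' = m ''c''" "m1 ''s'' = m ''s''"
      using ag by (simp_all add: agree_def)
    have ag': "agree probe_cells m m1" using ag by (simp add: agree_def probe_cells_def)
    obtain y r where r: "st = (y, r)" by fastforce
    show "wp (table N) (Cond (Less (Var ''found'') (Num 1))
      (Cond (Less (Var ''y'') (Times (Var ''a'') (Var ''b'')))
        (''found'' ::= Num 1 ;; ''fx'' ::= Var ''x'' ;; ''fc'' ::= Var ''c'' ;; ''fs'' ::= Var ''s'')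
        (''y'' ::= Minus (Var ''y'') (Times (Var ''a'') (Var ''b''))))
      Skip) (\<lambda>m' k'. k1 + k' \<le> 500 \<and> agree probe_cells m m' \<and>
    found_in (try_candidate (weight \<circ> extend C) (x, (c, s)) st) m') m1"
    proof (cases r)
      case None
      then have y: "m ''y'' 0 = int y" "m ''found'' 0 = 0" using st r by auto
      show ?thesis
      proof (cases "y < weight (extend C (x, (c, s)))")
        case True
        moreover have "agree probe_cells m (store ''fs'' 0 d4 (store ''fc'' 0 d3 (store ''fx'' 0 d2 (store ''found'' 0 d1 m1))))"
          for d1 d2 d3 d4 using ag' by (simp add: agree_def probe_cells_def store_def)
        ultimately show ?thesis using None r y v w k x ct by (simp del: extend.simps)
      next
        case False
        moreover have "agree probe_cells m (store ''y'' 0 d m1)"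
          for d using ag' by (simp add: agree_def probe_cells_def store_def)
        ultimately show ?thesis using None r y v w k by (simp del: extend.simps)
      qed
    next
      case (Some z)
      then show ?thesis using st r v k ag' by (cases z) auto
    qed
  qed
qed

definition search :: com where
  "search = ''found'' ::= Num 0 ;;
    For ''x'' (Plus (Plus (Var ''p'') (Var ''q'')) (Top ''len''))
      (For ''c'' (Plus (Var ''n'') (Num 1)) (For ''s'' (Plus (Var ''n'') (Num 1)) probe))"

definition search_cells :: "string set" where
  "search_cells = probe_cells \<union> {''x'', ''c'', ''s''}"

lemma width_le_mass: "width C \<le> mass C"
proof -
  obtain p q F where "C = ((p, q), F)" by (metis surj_pair)
  then show ?thesis by (cases F) (auto simp: width_def mass_def)
qed

lemma found_in_store: "z \<in> {''x'', ''c'', ''s'', ''k''} \<Longrightarrow> found_in st (store z i v m) \<longleftrightarrow> found_in st m"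
  by (cases "(st, m)" rule: found_in.cases) auto

text \<open>Three nested loops of at most \<open>n\<close>, \<open>n + 1\<close> and \<open>n + 1\<close> rounds.\<close>

lemma wp_search:
  assumes C: "config_in N C m" and mass: "mass C \<le> n" "n \<le> N" and n: "m ''n'' 0 = int n"
    and y: "m ''y'' 0 = int y"
  shows "wp (table N) search (\<lambda>m' k. k \<le> 600 * (n + 2) ^ 3 \<and> agree search_cells m m' \<and>
    found_in (fold (try_candidate (weight \<circ> extend C)) (candidates n C) (y, None)) m') m"
proof -
  let ?t = "try_candidate (weight \<circ> extend C)"
  define Rel where "Rel = (\<lambda>st m'. agree search_cells m m' \<and> found_in st m')"
  have st: "Rel st (store z 0 v m')" if "Rel st m'" "z \<in> {''x'', ''c'', ''s''}" for st m' z v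
  proof -
    have "found_in st (store z 0 v m')"
      using that by (subst found_in_store) (auto simp: Rel_def)
    moreover have "agree search_cells m (store z 0 v m')"
      using that by (auto simp: Rel_def agree_def store_def search_cells_def)
    ultimately show ?thesis by (simp add: Rel_def)
  qed
  have n': "m' ''n'' 0 = int n" and C': "config_in N C m'" if "Rel st m'" for st m'
    using that n C config_in_cong[of m' m N C]
    by (auto simp: Rel_def agree_def search_cells_def probe_cells_def)
  have W: "eval_exp (Plus (Plus (Var ''p'') (Var ''q'')) (Top ''len'')) m' = int (width C)" if "Rel st m'" for st m'
  proof -
    obtain p q F where "C = ((p, q), F)" by (metis surj_pair)
    then show ?thesis using C'[OF that] top_len_in[of N "(p, q)" F m'] by (simp add: width_def)
  qed
  let ?s = "For ''s'' (Plus (Var ''n'') (Num 1)) probe"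
  let ?c = "For ''c'' (Plus (Var ''n'') (Num 1)) ?s"
  let ?Bs = "Suc (Suc n) * (500 + 14 + 4)"
  let ?Bc = "Suc (Suc n) * (?Bs + 14 + 4)"
  have s: "wp (table N) ?s (\<lambda>m' k. k \<le> ?Bs \<and> (Rel (fold (\<lambda>s. ?t (x, (c, s))) [0..<Suc n] a) m' \<and> m' ''x'' 0 = int x) \<and> m' ''c'' 0 = int c) m'"
    if "x < width C" "Rel a m'" "m' ''x'' 0 = int x" "m' ''c'' 0 = int c" for a m' x c
  proof (rule wp_For[where M = "Suc n" and Rel = "\<lambda>a m'. Rel a m' \<and> m' ''x'' 0 = int x \<and> m' ''c'' 0 = int c"
        and B = 500 and f = "\<lambda>s. ?t (x, (c, s))" and a = a])
    fix k a m'
    assume k: "k < Suc n" and R: "Rel a m' \<and> m' ''x'' 0 = int x \<and> m' ''c'' 0 = int c" and s: "m' ''s'' 0 = int k"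
    have "wp (table N) probe (\<lambda>m'' k'. k' \<le> 500 \<and> agree probe_cells m' m'' \<and> found_in (?t (x, (c, k)) a) m'') m'"
      using R s that(1) mass by (intro wp_probe C') (auto simp: Rel_def)
    then show "wp (table N) probe (\<lambda>m'' t. t \<le> 500 \<and> (Rel (?t (x, (c, k)) a) m'' \<and> m'' ''x'' 0 = int x \<and> m'' ''c'' 0 = int c) \<and> m'' ''s'' 0 = int k) m'"
      by (rule wp_mono) (use R s in \<open>auto simp: Rel_def agree_def probe_cells_def search_cells_def\<close>)
  next
    show "eval_exp (Plus (Var ''n'') (Num 1)) m' = int (Suc n)"
      if "Rel a m' \<and> m' ''x'' 0 = int x \<and> m' ''c'' 0 = int c" for a m'
      using n'[of a m'] that by simp
  qed (use that st in auto)
  have c: "wp (table N) ?c (\<lambda>m' k. k \<le> ?Bc \<and> Rel (fold (\<lambda>c. fold (\<lambda>s. ?t (x, (c, s))) [0..<Suc n]) [0..<Suc n] a) m' \<and> m' ''x'' 0 = int x) m'"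
    if "x < width C" "Rel a m'" "m' ''x'' 0 = int x" for a m' x
  proof (rule wp_For[where M = "Suc n" and Rel = "\<lambda>a m'. Rel a m' \<and> m' ''x'' 0 = int x"
        and B = ?Bs and f = "\<lambda>c. fold (\<lambda>s. ?t (x, (c, s))) [0..<Suc n]" and a = a])
    fix k a m'
    assume "k < Suc n" "Rel a m' \<and> m' ''x'' 0 = int x" "m' ''c'' 0 = int k"
    then show "wp (table N) ?s (\<lambda>m' t. t \<le> ?Bs \<and> (Rel (fold (\<lambda>s. ?t (x, (k, s))) [0..<Suc n] a) m' \<and> m' ''x'' 0 = int x) \<and> m' ''c'' 0 = int k) m'"
      using s[of x a m' k] that(1) by blast
  next
    show "eval_exp (Plus (Var ''n'') (Num 1)) m' = int (Suc n)" if "Rel a m' \<and> m' ''x'' 0 = int x" for a m'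
      using n'[of a m'] that by simp
  qed (use that st in auto)
  have "wp (table N) (For ''x'' (Plus (Plus (Var ''p'') (Var ''q'')) (Top ''len'')) ?c)
    (\<lambda>m' k. 3 + k \<le> 600 * (n + 2) ^ 3 \<and> Rel (fold ?t (candidates n C) (y, None)) m') (store ''found'' 0 0 m)"
  proof (rule wp_For[where M = "width C" and Rel = Rel and B = ?Bc
        and f = "\<lambda>x. fold (\<lambda>c. fold (\<lambda>s. ?t (x, (c, s))) [0..<Suc n]) [0..<Suc n]" and a = "(y, None)"])
    show "Rel (y, None) (store ''found'' 0 0 m)"
      using y by (auto simp: Rel_def agree_def store_def search_cells_def probe_cells_def)
  next
    fix m' t
    assume R: "Rel (fold (\<lambda>x. fold (\<lambda>c. fold (\<lambda>s. ?t (x, (c, s))) [0..<Suc n]) [0..<Suc n]) [0..<width C] (y, None)) m'"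
      and t: "t \<le> Suc (width C) * (?Bc + 14 + cost_exp (Plus (Plus (Var ''p'') (Var ''q'')) (Top ''len'')))"
    \<comment> \<open>The 23 is 14 from \<open>wp_For\<close> and the cost 9 of evaluating the bound of the outer loop.\<close>
    have "t \<le> Suc (width C) * (?Bc + 23)" using t by simp
    also have "\<dots> \<le> (n + 2) * (?Bc + 23)" using width_le_mass[of C] mass by (intro mult_right_mono) auto
    also have "\<dots> = 518 * (n + 2) ^ 3 + 18 * (n + 2) ^ 2 + 23 * (n + 2)"
      by (simp add: power2_eq_square power3_eq_cube algebra_simps)
    also have "\<dots> \<le> 518 * (n + 2) ^ 3 + 18 * (n + 2) ^ 3 + 23 * (n + 2) ^ 3"
      using power_increasing[of 2 3 "n + 2"] power_increasing[of 1 3 "n + 2"]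
      by (intro add_mono mult_left_mono) auto
    finally have "3 + t \<le> 600 * (n + 2) ^ 3"
      using one_le_power[of "n + 2" 3] by linarith
    then show "3 + t \<le> 600 * (n + 2) ^ 3 \<and> Rel (fold ?t (candidates n C) (y, None)) m'"
      using R by (simp add: candidates_def fold_product del: upt_Suc)
  next
    show "eval_exp (Plus (Plus (Var ''p'') (Var ''q'')) (Top ''len'')) m' = int (width C)" if "Rel a m'" for a m'
      using W[OF that] .
  next
    show "wp (table N) ?c (\<lambda>m' t. t \<le> ?Bc \<and> Rel (fold (\<lambda>c. fold (\<lambda>s. ?t (k, (c, s))) [0..<Suc n]) [0..<Suc n] a) m'
        \<and> m' ''x'' 0 = int k) m'" if "k < width C" "Rel a m'" "m' ''x'' 0 = int k" for k a m'
      using c[OF that] .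
  qed (use st in auto)
  then show ?thesis unfolding search_def Rel_def by (simp, elim wp_mono) simp
qed

definition push :: com where
  "push = ''x'' ::= Var ''fx'' ;; ''c'' ::= Var ''fc'' ;; ''s'' ::= Var ''fs'' ;; weigh ;;
    ''p'' ::= Var ''p1'' ;; ''q'' ::= Var ''q1'' ;; Store ''len'' (Var ''d'') (Var ''j'') ;;
    ''d'' ::= Plus (Var ''d'') (Num 1) ;; Store ''len'' (Var ''d'') (Var ''i'') ;;
    Store ''tc'' (Var ''d'') (Var ''c'') ;; Store ''ts'' (Var ''d'') (Var ''s'') ;;
    Store ''below'' (Var ''d'') (Var ''b'')"

definition push_cells :: "string set" where
  "push_cells = {''x'', ''c'', ''s'', ''p1'', ''q1'', ''i'', ''j'', ''a'', ''b'', ''p'', ''q'', ''len'', ''d'', ''tc'', ''ts'', ''below''}"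

text \<open>A positive weight ensures that \<open>b\<close> was computed and is the product to be stored with the new
  frame.\<close>

lemma wp_push:
  assumes C: "config_in N C m" and mass: "mass C \<le> N"
    and st: "found_in (y, Some (x, (c, s))) m" and x: "x < width C"
    and pos: "0 < weight (extend C (x, (c, s)))"
  shows "wp (table N) push (\<lambda>m' k. k \<le> 500 \<and> agree push_cells m m' \<and>
    config_in N (extend C (x, (c, s))) m' \<and> m' ''x'' 0 = int x) m"
proof -
  obtain p q F where Ceq: "C = ((p, q), F)" by (metis surj_pair)
  obtain p' q' i j where b: "branch (p, q) (top_len F) x = ((p', q'), i, j)" by (metis surj_pair)
  have b': "branch (fst C) (top_len (snd C)) x = ((p', q'), i, j)" using b Ceq by simp
  have E: "extend C (x, (c, s)) = ((p', q'), (i, (c, s)) # set_top j F)" using b Ceq by simp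
  define m0 where "m0 = store ''s'' 0 (int s) (store ''c'' 0 (int c) (store ''x'' 0 (int x) m))"
  have C0: "config_in N C m0"
    using C config_in_cong[of m0 m N C] by (simp add: m0_def store_def)
  have "wp (table N) weigh (\<lambda>m' k. k \<le> 400 \<and> agree {''p1'', ''q1'', ''i'', ''j'', ''a'', ''b''} m0 m' \<and>
      m' ''p1'' 0 = int p' \<and> m' ''q1'' 0 = int q' \<and> m' ''i'' 0 = int i \<and> m' ''j'' 0 = int j \<and>
      m' ''b'' 0 = int (weight ((c, s), set_top j (snd C)))) m0"
    by (rule wp_weigh[OF C0 mass _ x _ _ b'])
      (use pos in \<open>auto simp: m0_def\<close>)
  then have "wp (table N) (weigh ;;
      ''p'' ::= Var ''p1'' ;; ''q'' ::= Var ''q1'' ;; Store ''len'' (Var ''d'') (Var ''j'') ;;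
      ''d'' ::= Plus (Var ''d'') (Num 1) ;; Store ''len'' (Var ''d'') (Var ''i'') ;;
      Store ''tc'' (Var ''d'') (Var ''c'') ;; Store ''ts'' (Var ''d'') (Var ''s'') ;;
      Store ''below'' (Var ''d'') (Var ''b''))
    (\<lambda>m' k. k \<le> 450 \<and> agree push_cells m m' \<and>
      config_in N (extend C (x, (c, s))) m' \<and> m' ''x'' 0 = int x) m0"
    unfolding wp.simps(5)[of _ weigh]
  proof (rule wp_mono)
    fix m1 and k :: nat
    assume *: "k \<le> 400 \<and> agree {''p1'', ''q1'', ''i'', ''j'', ''a'', ''b''} m0 m1 \<and>
      m1 ''p1'' 0 = int p' \<and> m1 ''q1'' 0 = int q' \<and> m1 ''i'' 0 = int i \<and> m1 ''j'' 0 = int j \<and>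
      m1 ''b'' 0 = int (weight ((c, s), set_top j (snd C)))"
    have v: "m1 ''d'' 0 = int (length F)" "m1 ''c'' 0 = int c" "m1 ''s'' 0 = int s" "m1 ''x'' 0 = int x"
      "m1 ''N'' 0 = int N" "m1 ''len'' 0 = 0"
      using * C Ceq by (simp_all add: agree_def m0_def)
    have F1: "frames_in F m1"
      using * C Ceq frames_in_cong[of F m1 m] by (simp add: agree_def m0_def)
    let ?d = "int (length F)"
    let ?m2 = "store ''below'' (?d + 1) (m1 ''b'' 0) (store ''ts'' (?d + 1) (int s) (store ''tc'' (?d + 1) (int c)
      (store ''len'' (?d + 1) (int i) (store ''d'' 0 (?d + 1) (store ''len'' ?d (int j)
      (store ''q'' 0 (int q') (store ''p'' 0 (int p') m1)))))))"
    have ag: "agree push_cells m ?m2"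
      using * by (auto simp: agree_def push_cells_def store_def m0_def)
    have "frames_in (set_top j F) ?m2"
    proof (cases F)
      case (Cons f F')
      obtain l c0 s0 where f: "f = (l, (c0, s0))" by (metis surj_pair)
      have "frames_in F' ?m2 \<longleftrightarrow> frames_in F' m1"
        using Cons by (intro frames_in_cong) auto
      then show ?thesis using F1 Cons f by auto
    qed simp
    \<comment> \<open>At an empty stack the store to \<open>len\<close> hits cell 0, which must stay 0.\<close>
    moreover have "F = [] \<Longrightarrow> j = 0"
      using branch_zero[OF _ b] x Ceq by (simp add: width_def)
    moreover have "length (set_top j F) = length F" by (cases F rule: top_len.cases) auto
    ultimately have "config_in N (extend C (x, (c, s))) ?m2"
      unfolding E using * v Ceq by auto
    then show "wp (table N) (''p'' ::= Var ''p1'' ;; ''q'' ::= Var ''q1'' ;; Store ''len'' (Var ''d'') (Var ''j'') ;;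
      ''d'' ::= Plus (Var ''d'') (Num 1) ;; Store ''len'' (Var ''d'') (Var ''i'') ;;
      Store ''tc'' (Var ''d'') (Var ''c'') ;; Store ''ts'' (Var ''d'') (Var ''s'') ;;
      Store ''below'' (Var ''d'') (Var ''b''))
      (\<lambda>m' k'. k + k' \<le> 450 \<and> agree push_cells m m' \<and>
      config_in N (extend C (x, (c, s))) m' \<and> m' ''x'' 0 = int x) m1"
      using * v ag by (simp del: extend.simps config_in.simps)
  qed
  then show ?thesis
    unfolding push_def wp.simps(5)[of _ "Store _ _ _"] wp.simps(2) using st
    by (simp add: m0_def[symmetric] del: wp.simps) (elim wp_mono, simp)
qed

section \<open>The main loop\<close>

text \<open>Writes the remaining value of rank \<open>x\<close> and deletes it from \<open>rem\<close> by shifting the cells after it. The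
  shift also moves cells behind the last remaining value; their content never reaches the output.\<close>

definition emit :: com where
  "emit = Store ''out'' (Var ''t'') (Cell ''rem'' (Var ''x'')) ;;
    For ''k'' (Var ''n'') (Cond (Less (Var ''k'') (Var ''x'')) Skip
      (Store ''rem'' (Var ''k'') (Cell ''rem'' (Plus (Var ''k'') (Num 1))))) ;;
    ''t'' ::= Plus (Var ''t'') (Num 1)"

lemma fold_delete:
  fixes g :: "int \<Rightarrow> int"
  shows "fold (\<lambda>k g. if k < x then g else g(int k := g (int k + 1))) [0..<M] g (int i) =
    (if x \<le> i \<and> i < M then g (int i + 1) else g (int i))"
  by (induction M arbitrary: i) (auto split: if_splits simp: of_nat_Suc[symmetric] add.commute simp del: of_nat_Suc)

definition emit_cells :: "string set" where
  "emit_cells = {''out'', ''rem'', ''k'', ''t''}"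

lemma wp_emit:
  assumes n: "m ''n'' 0 = int n" and t: "m ''t'' 0 = int t" and x: "m ''x'' 0 = int x"
    and vs: "\<forall>i<length vs. m ''rem'' (int i) = int (vs ! i)" "x < length vs" "length vs \<le> n"
  shows "wp tab emit (\<lambda>m' k. k \<le> 60 * (n + 2) \<and> agree emit_cells m m' \<and> m' ''t'' 0 = int (Suc t) \<and>
    m' ''out'' = (m ''out'')(int t := int (vs ! x)) \<and>
    (\<forall>i<length vs - 1. m' ''rem'' (int i) = int ((take x vs @ drop (Suc x) vs) ! i))) m"
proof -
  define m0 where "m0 = store ''out'' (int t) (int (vs ! x)) m"
  let ?f = "\<lambda>k g. if k < x then g else g(int k := g (int k + 1))"
  define Rel where "Rel = (\<lambda>g m'. agree {''rem'', ''k''} m0 m' \<and> m' ''rem'' = g)"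
  have v: "m' ''n'' 0 = int n" "m' ''x'' 0 = int x" "m' ''t'' 0 = int t" if "Rel g m'" for g m'
    using that n x t by (auto simp: Rel_def agree_def m0_def)
  have "wp tab (For ''k'' (Var ''n'') (Cond (Less (Var ''k'') (Var ''x'')) Skip
      (Store ''rem'' (Var ''k'') (Cell ''rem'' (Plus (Var ''k'') (Num 1))))))
      (\<lambda>m' k. k \<le> Suc n * 46 \<and> Rel (fold ?f [0..<n] (m ''rem'')) m') m0"
  proof (rule wp_For[where M = n and Rel = Rel and f = ?f and a = "m ''rem''" and B = 30])
    show "Rel (m ''rem'') m0" by (simp add: Rel_def agree_def m0_def store_def)
  next
    show "eval_exp (Var ''n'') m' = int n" if "Rel a m'" for a m' using v[OF that] by simp
  next
    show "Rel a (store ''k'' 0 z m')" if "Rel a m'" for a m' z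
      using that by (auto simp: Rel_def agree_def store_def)
  next
    fix k a m' assume "k < n" and R: "Rel a m'" and k: "m' ''k'' 0 = int k"
    show "wp tab (Cond (Less (Var ''k'') (Var ''x'')) Skip
      (Store ''rem'' (Var ''k'') (Cell ''rem'' (Plus (Var ''k'') (Num 1)))))
      (\<lambda>m' t. t \<le> 30 \<and> Rel (?f k a) m' \<and> m' ''k'' 0 = int k) m'"
      using R k v[OF R] by (auto simp: Rel_def agree_def store_def)
  qed auto
  then have "wp tab (For ''k'' (Var ''n'') (Cond (Less (Var ''k'') (Var ''x'')) Skip
      (Store ''rem'' (Var ''k'') (Cell ''rem'' (Plus (Var ''k'') (Num 1))))) ;;
      ''t'' ::= Plus (Var ''t'') (Num 1))
    (\<lambda>m' k. k \<le> 58 * Suc n \<and> agree emit_cells m m' \<and> m' ''t'' 0 = int (Suc t) \<and>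
      m' ''out'' = (m ''out'')(int t := int (vs ! x)) \<and>
      (\<forall>i<length vs - 1. m' ''rem'' (int i) = int ((take x vs @ drop (Suc x) vs) ! i))) m0"
    unfolding wp.simps(5)
  proof (rule wp_mono)
    fix m' and k :: nat assume *: "k \<le> Suc n * 46 \<and> Rel (fold ?f [0..<n] (m ''rem'')) m'"
    have "m' ''rem'' (int i) = int ((take x vs @ drop (Suc x) vs) ! i)" if i: "i < length vs - 1" for i
    proof -
      have "i < n" using i vs(3) by linarith
      then have "m' ''rem'' (int i) = (if x \<le> i then m ''rem'' (int i + 1) else m ''rem'' (int i))"
        using * by (simp add: Rel_def fold_delete)
      also have "\<dots> = int (if x \<le> i then vs ! Suc i else vs ! i)"
        using vs(1)[rule_format, of i] vs(1)[rule_format, of "Suc i"] i by (simp add: add.commute)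
      also have "\<dots> = int ((take x vs @ drop (Suc x) vs) ! i)"
        using vs i by (auto simp: nth_append)
      finally show ?thesis .
    qed
    moreover have "agree emit_cells m (store ''t'' 0 z m')" for z
      using * by (auto simp: Rel_def agree_def emit_cells_def m0_def store_def)
    moreover have "m' ''out'' = (m ''out'')(int t := int (vs ! x))"
      using * by (auto simp: Rel_def agree_def m0_def store_def)
    ultimately show "wp tab (''t'' ::= Plus (Var ''t'') (Num 1)) (\<lambda>m'' k'. k + k' \<le> 58 * Suc n \<and> agree emit_cells m m'' \<and>
       m'' ''t'' 0 = int (Suc t) \<and> m'' ''out'' = (m ''out'')(int t := int (vs ! x)) \<and>
      (\<forall>i<length vs - 1. m'' ''rem'' (int i) = int ((take x vs @ drop (Suc x) vs) ! i))) m'"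
      using * v(3)[OF conjunct2[OF *]] by (simp add: fun_eq_iff)
  qed
  then show ?thesis
    unfolding emit_def wp.simps(5)[of _ "Store _ _ _"] wp.simps(2) using t x vs(1,2)
    by (simp add: m0_def[symmetric] del: wp.simps) (elim wp_mono, simp)
qed

definition iteration :: com where
  "iteration = Cond (BAnd (Less (Num 0) (Var ''d'')) (Less (Top ''len'') (Num 1)))
    (''d'' ::= Minus (Var ''d'') (Num 1))
    (search ;; push ;; emit)"

text \<open>The loop invariant: what has been written, followed by what the present rank decodes to, is the final
  output \<open>\<pi>\<close>, and \<open>r\<close> bounds the number of iterations to come.\<close>

definition running :: "nat \<Rightarrow> nat \<Rightarrow> nat list \<Rightarrow> nat \<Rightarrow> memory \<Rightarrow> bool" where
  "running N n \<pi> r m \<longleftrightarrow> (\<exists>C y us vs. config_in N C m \<and> m ''n'' 0 = int n \<and> m ''y'' 0 = int y \<and>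
     m ''t'' 0 = int (length us) \<and> (\<forall>i<length us. m ''out'' (int i) = int (us ! i)) \<and>
     (\<forall>i<length vs. m ''rem'' (int i) = int (vs ! i)) \<and>
     length vs = mass C \<and> length us + length vs = n \<and> y < weight C \<and> fuel C \<le> r \<and>
     us @ decode vs (unrank n r C y) = \<pi>)"

lemma wp_iteration:
  assumes "n \<le> N" and I: "running N n \<pi> r m" and guard: "m ''t'' 0 < int n"
  shows "wp (table N) iteration (\<lambda>m' k. k \<le> 1300 * (n + 2) ^ 3 \<and> (\<exists>r'<r. running N n \<pi> r' m')) m"
proof -
  obtain C y us vs where C: "config_in N C m" and n: "m ''n'' 0 = int n" and y: "m ''y'' 0 = int y"
    and t: "m ''t'' 0 = int (length us)" and out: "\<forall>i<length us. m ''out'' (int i) = int (us ! i)"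
    and rem: "\<forall>i<length vs. m ''rem'' (int i) = int (vs ! i)"
    and len: "length vs = mass C" "length us + length vs = n" and yw: "y < weight C" and fuel: "fuel C \<le> r"
    and result: "us @ decode vs (unrank n r C y) = \<pi>"
    using I unfolding running_def by blast
  obtain p q F where Ceq: "C = ((p, q), F)" by (metis surj_pair)
  have mass: "0 < mass C" "mass C \<le> n" using guard t len by auto
  then obtain r' where r: "r = Suc r'" using fuel by (cases r) (auto simp: fuel_def)
  have d: "m ''d'' 0 = int (length F)" and top: "m ''len'' (m ''d'' 0) = int (top_len F)"
    using C Ceq top_len_in[of N "(p, q)" F m] by auto
  define D where "D = (n + 2) ^ 3"
  have cube: "1 \<le> (n + 2) ^ 3" "n + 2 \<le> (n + 2) ^ 3"
    using one_le_power[of "n + 2" 3] power_increasing[of 1 3 "n + 2"] by auto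
  show ?thesis
  proof (cases "F \<noteq> [] \<and> top_len F = 0")
    case True
    then obtain cs F' where F: "F = (0, cs) # F'" by (cases F) auto
    \<comment> \<open>A positive weight forces the target of a used-up frame to be the present control.\<close>
    have cs: "cs = (p, q)" using yw Ceq F by (auto simp: Kz_0 split: if_splits)
    let ?C = "((p, q), F')"
    have "config_in N ?C (store ''d'' 0 (int (length F')) m)"
      using C Ceq F frames_in_cong[of F' "store ''d'' 0 (int (length F')) m" m] by (cases cs) auto
    moreover have "unrank n r C y = unrank n r' ?C y" using r Ceq F by simp
    moreover have "weight ?C = weight C" using Ceq F cs by (simp add: Kz_0)
    moreover have "mass ?C = mass C" "fuel ?C \<le> r'" using Ceq F fuel r by (auto simp: mass_def fuel_def)
    ultimately have "running N n \<pi> r' (store ''d'' 0 (int (length F')) m)"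
      using n y t out rem len yw result unfolding running_def
      by (intro exI[of _ ?C] exI[of _ y] exI[of _ us] exI[of _ vs]) simp
    then show ?thesis using True d top r F cube unfolding iteration_def by auto
  next
    case False
    have "0 < width C" using mass False Ceq by (cases F) (auto simp: width_def mass_def)
    let ?w = "weight \<circ> extend C" and ?zs = "candidates n C"
    have cond: "snd C \<noteq> [] \<Longrightarrow> top_len (snd C) \<noteq> 0" "width C \<noteq> 0"
      using False Ceq \<open>0 < width C\<close> by auto
    have bij: "bij_betw (locate ?w ?zs) {..<weight C} (Sigma (set ?zs) (\<lambda>z. {..<weight (extend C z)}))"
      using cond mass(2) by (rule bij_betw_locate_candidates)
    have sum: "weight C = sum_list (map ?w ?zs)"
      using weight_eq_sum[OF cond mass(2)] by (simp add: o_def)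
    obtain x c s y' where loc: "locate ?w ?zs y = ((x, (c, s)), y')" by (metis surj_pair)
    have "((x, (c, s)), y') \<in> Sigma (set ?zs) (\<lambda>z. {..<weight (extend C z)})"
      using bij_betw_apply[OF bij, of y] yw loc by simp
    then have z: "x < width C" "y' < weight (extend C (x, (c, s)))" by (auto simp: candidates_def)
    let ?C = "extend C (x, (c, s))"
    have found: "fold (try_candidate ?w) ?zs (y, None) = (y', Some (x, (c, s)))"
      using fold_try_candidate[of y ?w ?zs] yw sum loc by simp
    have unr: "unrank n r C y = x # unrank n r' ?C y'"
    proof -
      have "\<not> (snd C \<noteq> [] \<and> top_len (snd C) = 0)" using cond(1) by blast
      then show ?thesis
        unfolding r unrank.simps(2) using cond(2) by (simp only: if_False loc prod.case fst_conv)
    qed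
    have xl: "x < length vs" using z width_le_mass[of C] len by simp
    have "wp (table N) search (\<lambda>m1 k1. wp (table N) (push ;; emit)
        (\<lambda>m' k. k1 + k \<le> 1200 * (n + 2) ^ 3 \<and> running N n \<pi> r' m') m1) m"
    proof (rule wp_mono[OF wp_search[OF C mass(2) assms(1) n y]])
      fix m1 and k1 :: nat
      assume "k1 \<le> 600 * (n + 2) ^ 3 \<and> agree search_cells m m1 \<and> found_in (fold (try_candidate ?w) ?zs (y, None)) m1"
      then have 1: "k1 \<le> 600 * (n + 2) ^ 3" "agree search_cells m m1" "found_in (y', Some (x, (c, s))) m1"
        using found by simp_all
      have C1: "config_in N C m1"
        using C 1(2) config_in_cong[of m1 m N C] by (auto simp: agree_def search_cells_def probe_cells_def)
      have mN: "mass C \<le> N" using mass assms(1) by simp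
      have pos: "0 < weight ?C" using z by simp
      show "wp (table N) (push ;; emit) (\<lambda>m' k. k1 + k \<le> 1200 * (n + 2) ^ 3 \<and> running N n \<pi> r' m') m1"
        unfolding wp.simps(5)
      proof (rule wp_mono[OF wp_push[OF C1 mN 1(3) z(1) pos]])
        fix m2 and k2 :: nat
        assume 2: "k2 \<le> 500 \<and> agree push_cells m1 m2 \<and> config_in N ?C m2 \<and> m2 ''x'' 0 = int x"
        have v: "m2 ''n'' 0 = int n" "m2 ''t'' 0 = int (length us)" "m2 ''rem'' = m ''rem''" "m2 ''out'' = m ''out''"
          "m2 ''y'' 0 = int y'"
          using 1 2 n t by (auto simp: agree_def search_cells_def push_cells_def probe_cells_def)
        have rem2: "\<forall>i<length vs. m2 ''rem'' (int i) = int (vs ! i)" using rem v by simp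
        have vn: "length vs \<le> n" using len by simp
        show "wp (table N) emit (\<lambda>m' k. k1 + (k2 + k) \<le> 1200 * (n + 2) ^ 3 \<and> running N n \<pi> r' m') m2"
        proof (rule wp_mono[OF wp_emit[OF v(1,2) conjunct2[OF conjunct2[OF conjunct2[OF 2]]] rem2 xl vn]], intro conjI)
          fix m' and k :: nat
          assume 3: "k \<le> 60 * (n + 2) \<and> agree emit_cells m2 m' \<and> m' ''t'' 0 = int (Suc (length us)) \<and>
            m' ''out'' = (m2 ''out'')(int (length us) := int (vs ! x)) \<and>
            (\<forall>i<length vs - 1. m' ''rem'' (int i) = int ((take x vs @ drop (Suc x) vs) ! i))"
          have "k2 \<le> 500" "k \<le> 60 * (n + 2)" using 2 3 by blast+
          then show "k1 + (k2 + k) \<le> 1200 * (n + 2) ^ 3" using 1(1) cube unfolding D_def[symmetric] by simp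
          have "config_in N ?C m'"
            using 2 3 config_in_cong[of m' m2 N ?C] by (auto simp: agree_def emit_cells_def simp del: extend.simps)
          moreover have "m' ''n'' 0 = int n" "m' ''y'' 0 = int y'"
            using v 3 by (auto simp: agree_def emit_cells_def)
          moreover have "Suc (mass ?C) = mass C" "Suc (fuel ?C) = fuel C"
            using mass_extend[OF z(1)] fuel_extend[OF z(1)] by auto
          ultimately show "running N n \<pi> r' m'"
            using v 3 out result unr len z fuel r xl unfolding running_def
            by (intro exI[of _ ?C] exI[of _ y'] exI[of _ "us @ [vs ! x]"] exI[of _ "take x vs @ drop (Suc x) vs"])
              (auto simp: nth_append simp del: extend.simps)
        qed
      qed
    qed
    then have "wp (table N) (search ;; push ;; emit) (\<lambda>m' k. k \<le> 1200 * (n + 2) ^ 3 \<and> running N n \<pi> r' m') m"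
      by simp
    then have "wp (table N) (search ;; push ;; emit)
        (\<lambda>m' k. 1 + cost_bexp (BAnd (Less (Num 0) (Var ''d'')) (Less (Top ''len'') (Num 1))) + k \<le> 1300 * (n + 2) ^ 3 \<and>
          (\<exists>r'<r. running N n \<pi> r' m')) m"
    proof (rule wp_mono)
      fix m' and k :: nat
      assume *: "k \<le> 1200 * (n + 2) ^ 3 \<and> running N n \<pi> r' m'"
      have "1 + cost_bexp (BAnd (Less (Num 0) (Var ''d'')) (Less (Top ''len'') (Num 1))) \<le> 20" by simp
      moreover have "k \<le> 1200 * (n + 2) ^ 3" using * by blast
      ultimately have "1 + cost_bexp (BAnd (Less (Num 0) (Var ''d'')) (Less (Top ''len'') (Num 1))) + k \<le> 1300 * (n + 2) ^ 3"
        using cube unfolding D_def[symmetric] by simp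
      then show "1 + cost_bexp (BAnd (Less (Num 0) (Var ''d'')) (Less (Top ''len'') (Num 1))) + k \<le> 1300 * (n + 2) ^ 3 \<and>
          (\<exists>r'<r. running N n \<pi> r' m')" using * r by blast
    qed
    moreover have "\<not> eval_bexp (BAnd (Less (Num 0) (Var ''d'')) (Less (Top ''len'') (Num 1))) m"
      using False d top by (cases F) auto
    ultimately show ?thesis unfolding iteration_def wp.simps(6)[of _ "BAnd _ _"] by (simp only: if_False)
  qed
qed

lemma unrank_mass_0: "mass C = 0 \<Longrightarrow> unrank n r C y = []"
proof (induction r arbitrary: C)
  case (Suc r)
  have "mass (fst C, tl (snd C)) = 0" using Suc.prems by (cases "snd C") (auto simp: mass_def)
  moreover have "width C = 0" using Suc.prems width_le_mass[of C] by simp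
  ultimately show ?case using Suc.IH by simp
qed simp

definition unranker :: com where
  "unranker = ''p'' ::= Var ''n'' ;;
    For ''k'' (Var ''n'') (Store ''rem'' (Var ''k'') (Plus (Var ''k'') (Num 1))) ;;
    While (Less (Var ''t'') (Var ''n'')) iteration"

definition sampler :: com where
  "sampler = Draw ''y'' (Num 0) (G_ref (Var ''n'') (Num 0)) ;; unranker"

definition nth_perm :: "nat \<Rightarrow> nat \<Rightarrow> nat list" where
  "nth_perm n y = decode [1..<Suc n] (unrank n (2 * n) ((n, 0), []) y)"

lemma bij_betw_nth_perm: "bij_betw (nth_perm n) {..<G (n, 0)} (Av n [1, 2, 4, 5, 3])"
proof -
  have "bij_betw (unrank n (2 * n) ((n, 0), [])) {..<G (n, 0)} {xs. complete ((n, 0), []) xs}"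
    using bij_betw_unrank[of "((n, 0), [])" "2 * n" n] by (simp add: fuel_def mass_def)
  from bij_betw_trans[OF this bij_betw_decode] show ?thesis
    by (simp add: nth_perm_def[abs_def] o_def del: upt_Suc)
qed

lemma fold_init:
  fixes g :: "int \<Rightarrow> int"
  shows "fold (\<lambda>k g. g(int k := int k + 1)) [0..<M] g (int i) = (if i < M then int i + 1 else g (int i))"
  by (induction M) auto

lemma wp_unranker:
  assumes "n \<le> N" and y: "y < G (n, 0)"
  shows "wp (table N) unranker (\<lambda>m' k. k \<le> 4000 * (n + 2) ^ 4 \<and> out_list n m' = map int (nth_perm n y))
    (store ''y'' 0 (int y) (input N n))"
proof -
  define m0 where "m0 = store ''p'' 0 (int n) (store ''y'' 0 (int y) (input N n))"
  have n_in: "input N n ''n'' 0 = int n" by (simp add: input_def)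
  let ?f = "\<lambda>k g. g(int k := int k + 1)"
  define Rel where "Rel = (\<lambda>g m'. agree {''rem'', ''k''} m0 m' \<and> m' ''rem'' = g)"
  let ?I = "running N n (nth_perm n y)"
  have "wp (table N) (For ''k'' (Var ''n'') (Store ''rem'' (Var ''k'') (Plus (Var ''k'') (Num 1))))
    (\<lambda>m' k. k \<le> Suc n * 23 \<and> ?I (2 * n) m') m0"
  proof (rule wp_For[where M = n and Rel = Rel and f = ?f and a = "m0 ''rem''" and B = 7])
    show "Rel (m0 ''rem'') m0" by (simp add: Rel_def agree_def)
  next
    show "Rel a (store ''k'' 0 z m')" if "Rel a m'" for a m' z
      using that by (auto simp: Rel_def agree_def store_def)
  next
    show "eval_exp (Var ''n'') m' = int n" if "Rel a m'" for a m'
      using that by (simp add: Rel_def agree_def m0_def input_def)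
  next
    show "wp (table N) (Store ''rem'' (Var ''k'') (Plus (Var ''k'') (Num 1)))
        (\<lambda>m' t. t \<le> 7 \<and> Rel (?f k a) m' \<and> m' ''k'' 0 = int k) m'"
      if "Rel a m'" "m' ''k'' 0 = int k" for k a m'
      using that by (auto simp: Rel_def agree_def store_def)
  next
    fix m' t assume R: "Rel (fold ?f [0..<n] (m0 ''rem'')) m'" and t: "t \<le> Suc n * (7 + 14 + cost_exp (Var ''n''))"
    have "m' z = m0 z" if "z \<noteq> ''rem''" "z \<noteq> ''k''" for z using R that by (simp add: Rel_def agree_def)
    moreover have "m' ''rem'' (int i) = int ([1..<Suc n] ! i)" if "i < n" for i
      using R that by (simp add: Rel_def fold_init del: upt_Suc)
    ultimately have "?I (2 * n) m'" unfolding running_def using y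
      by (intro exI[of _ "((n, 0), [])"] exI[of _ y] exI[of _ "[]"] exI[of _ "[1..<Suc n]"])
        (simp add: m0_def input_def mass_def fuel_def nth_perm_def del: upt_Suc)
    then show "t \<le> Suc n * 23 \<and> ?I (2 * n) m'" using t by simp
  qed
  then have "wp (table N) (For ''k'' (Var ''n'') (Store ''rem'' (Var ''k'') (Plus (Var ''k'') (Num 1))) ;;
      While (Less (Var ''t'') (Var ''n'')) iteration)
    (\<lambda>m' k. 4 + k \<le> 4000 * (n + 2) ^ 4 \<and> out_list n m' = map int (nth_perm n y)) m0"
    unfolding wp.simps(5)
  proof (rule wp_mono)
    fix m1 and k1 :: nat
    assume 1: "k1 \<le> Suc n * 23 \<and> ?I (2 * n) m1"
    then have I: "?I (2 * n) m1" by blast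
    show "wp (table N) (While (Less (Var ''t'') (Var ''n'')) iteration)
      (\<lambda>m' k. 4 + (k1 + k) \<le> 4000 * (n + 2) ^ 4 \<and> out_list n m' = map int (nth_perm n y)) m1"
    proof (rule wp_While[where I = ?I and B = "1300 * (n + 2) ^ 3", OF _ I])
      fix r m assume r: "?I r m" "eval_bexp (Less (Var ''t'') (Var ''n'')) m"
      have "m ''n'' 0 = int n" using r(1) unfolding running_def by blast
      then show "wp (table N) iteration (\<lambda>m' k. k \<le> 1300 * (n + 2) ^ 3 \<and> (\<exists>r'<r. ?I r' m')) m"
        using r by (intro wp_iteration assms(1)) auto
    next
      fix r m and k :: nat
      assume r: "?I r m" "\<not> eval_bexp (Less (Var ''t'') (Var ''n'')) m"
        and k: "k \<le> Suc (2 * n) * (1300 * (n + 2) ^ 3 + 1 + cost_bexp (Less (Var ''t'') (Var ''n'')))"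
      obtain C z us vs where *: "m ''n'' 0 = int n" "m ''t'' 0 = int (length us)"
        "\<forall>i<length us. m ''out'' (int i) = int (us ! i)" "length vs = mass C" "length us + length vs = n"
        and result: "us @ decode vs (unrank n r C z) = nth_perm n y"
        using r(1) unfolding running_def by blast
      then have "length us = n" "mass C = 0" using r(2) by auto
      \<comment> \<open>No value is left, so the rest of the output is empty.\<close>
      then have "us = nth_perm n y" using result unrank_mass_0[of C n r z] by simp
      moreover have "out_list n m = map int us"
        using * \<open>length us = n\<close> by (auto simp: out_list_def intro: nth_equalityI)
      moreover have "4 + (k1 + k) \<le> 4000 * (n + 2) ^ 4"
      proof -
        define D where "D = (n + 2) ^ 4"
        have D: "(n + 2) ^ 3 * (n + 2) = D" "n + 2 \<le> D"
          using power_increasing[of 1 4 "n + 2"] by (simp_all add: D_def eval_nat_numeral)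
        have "cost_bexp (Less (Var ''t'') (Var ''n'')) = 5" by simp
        with k have "k \<le> Suc (2 * n) * (1300 * (n + 2) ^ 3 + 1 + 5)" by (simp only:)
        also have "\<dots> \<le> (2 * (n + 2)) * (1300 * (n + 2) ^ 3 + 1 + 5)" by (intro mult_right_mono) auto
        also have "\<dots> = 2600 * ((n + 2) ^ 3 * (n + 2)) + 12 * (n + 2)" by (simp add: algebra_simps)
        finally have "k \<le> 2600 * D + 12 * (n + 2)" unfolding D(1) .
        moreover have "k1 \<le> 23 * (n + 2)" using 1 by simp
        ultimately show ?thesis unfolding D_def[symmetric] using D(2) by simp
      qed
      ultimately show "4 + (k1 + k) \<le> 4000 * (n + 2) ^ 4 \<and> out_list n m = map int (nth_perm n y)"
        by simp
    qed
  qed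
  then show ?thesis
    unfolding unranker_def wp.simps(5)[of _ "Store _ _ _"] wp.simps(2)
    by (simp add: n_in m0_def[symmetric] del: wp.simps) (elim wp_mono, simp)
qed

theorem proposition8p1:
  shows "\<exists>(c :: com) (T :: nat \<Rightarrow> nat).
    (\<lambda>n. real (T n)) \<in> O(\<lambda>n. real n ^ 4) \<and>
    (\<forall>N n. n \<le> N \<longrightarrow>
       map_spmf fst (run c N n) = spmf_of_set (map int ` Av n [1,2,4,5,3]) \<and>
       (\<forall>(\<pi>, t) \<in> set_spmf (run c N n). t \<le> T n))"
proof (intro exI[of _ sampler] exI[of _ "\<lambda>n. 4010 * (n + 2) ^ 4"] conjI allI impI)
  show "(\<lambda>n. real (4010 * (n + 2) ^ 4)) \<in> O(\<lambda>n. real n ^ 4)"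
  proof (rule bigoI[where c = "4010 * 3 ^ 4"], rule eventually_mono[OF eventually_ge_at_top[of 1]])
    fix n :: nat assume "1 \<le> n"
    \<comment> \<open>For \<open>n \<ge> 1\<close> the base \<open>n + 2\<close> is at most \<open>3 n\<close>.\<close>
    then have "real (n + 2) ^ 4 \<le> (3 * real n) ^ 4" by (intro power_mono) auto
    then show "norm (real (4010 * (n + 2) ^ 4)) \<le> 4010 * 3 ^ 4 * norm (real n ^ 4)"
      by (simp add: power_mult_distrib)
  qed
next
  fix N n :: nat assume n: "n \<le> N"
  let ?Y = "{0..<int (G (n, 0))}"
  let ?m = "\<lambda>v. store ''y'' 0 v (input N n)"
  have ex: "\<exists>m' k. (\<forall>t. exec (table N) unranker (?m v, t) = return_spmf (m', t + k)) \<and>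
      k \<le> 4000 * (n + 2) ^ 4 \<and> out_list n m' = map int (nth_perm n (nat v))" if "v \<in> ?Y" for v
    using wp_sound[OF wp_unranker[OF n, of "nat v"]] that by auto
  then obtain M k where Mk: "\<And>v t. v \<in> ?Y \<Longrightarrow> exec (table N) unranker (?m v, t) = return_spmf (M v, t + k v)"
    "\<And>v. v \<in> ?Y \<Longrightarrow> k v \<le> 4000 * (n + 2) ^ 4" "\<And>v. v \<in> ?Y \<Longrightarrow> out_list n (M v) = map int (nth_perm n (nat v))"
    by metis
  \<comment> \<open>The draw costs 6.\<close>
  have "run sampler N n = map_spmf (\<lambda>(m, t). (out_list n m, t))
      (bind_spmf (map_spmf (\<lambda>v. (?m v, 6)) (spmf_of_set ?Y)) (exec (table N) unranker))"
    using n by (simp add: run_def sampler_def input_def eval_nat_numeral)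
  also have "\<dots> = bind_spmf (spmf_of_set ?Y)
      (\<lambda>v. map_spmf (\<lambda>(m, t). (out_list n m, t)) (exec (table N) unranker (?m v, 6)))"
    by (simp add: map_spmf_bind_spmf bind_map_spmf o_def)
  also have "\<dots> = bind_spmf (spmf_of_set ?Y) (\<lambda>v. return_spmf (map int (nth_perm n (nat v)), 6 + k v))"
    using Mk(1,3) by (intro bind_spmf_cong) auto
  finally have run: "run sampler N n = map_spmf (\<lambda>v. (map int (nth_perm n (nat v)), 6 + k v)) (spmf_of_set ?Y)"
    by (simp add: map_spmf_conv_bind_spmf)
  have "bij_betw nat ?Y {..<G (n, 0)}"
    by (rule bij_betwI[where g = int]) auto
  from bij_betw_trans[OF this bij_betw_nth_perm] have b: "bij_betw (nth_perm n \<circ> nat) ?Y (Av n [1, 2, 4, 5, 3])" .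
  have "inj_on (map int) X" for X
    by (rule inj_onI) (simp add: inj_map_eq_map[OF inj_of_nat])
  then have "inj_on (map int \<circ> (nth_perm n \<circ> nat)) ?Y"
    by (intro comp_inj_on[OF bij_betw_imp_inj_on[OF b]])
  then have "map_spmf (map int \<circ> (nth_perm n \<circ> nat)) (spmf_of_set ?Y) = spmf_of_set (map int ` Av n [1, 2, 4, 5, 3])"
    by (simp only: map_spmf_of_set_inj_on image_comp[symmetric] bij_betw_imp_surj_on[OF b, unfolded image_comp[symmetric]])
  then show "map_spmf fst (run sampler N n) = spmf_of_set (map int ` Av n [1, 2, 4, 5, 3])"
    unfolding run by (simp add: spmf.map_comp o_def)
  have "6 + k v \<le> 4010 * (n + 2) ^ 4" if "v \<in> ?Y" for v
  proof -
    define D where "D = (n + 2) ^ 4"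
    have "1 \<le> D" unfolding D_def by (rule one_le_power) simp
    then show ?thesis using Mk(2)[OF that] unfolding D_def[symmetric] by simp
  qed
  then show "\<forall>(\<pi>, t) \<in> set_spmf (run sampler N n). t \<le> 4010 * (n + 2) ^ 4"
    unfolding run by (auto simp: set_spmf_of_set)
qed

end
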